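(* Let $A$, $B$ be Hopf algebras. For any $A*B$-bimodule $M$ and any $n\geq 2$, there is a natural isomorphism $$H^n(A*B,M)\simeq H^n(A,M)\oplus H^n(B,M),$$ where $M$ has the respective restricted $A$-bimodule and $B$-bimodule structures.
   Context: All algebras are over $\mathbb{C}$. $H^*(A,-)$ denotes Hochschild cohomology of the algebra $A$ with coefficients in $A$-bimodules. $A*B$ is the free product (coproduct of unital algebras), endowed with its unique Hopf algebra structure such that the canonical morphisms $A\to A*B$ and $B\to A*B$ are Hopf algebra maps. *)

theory Defs
  imports Complex_Main "HOL-Library.Function_Algebras" "HOL-Library.Set_Algebras"
begin

section \<open>Complex vector spaces and unital complex algebras\<close>

class scaleC =
  fixes scaleC :: "complex \<Rightarrow> 'a \<Rightarrow> 'a" (infixr "*\<^sub>C" 75)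

class complex_vector = scaleC + ab_group_add +
  assumes scaleC_add_right: "a *\<^sub>C (x + y) = a *\<^sub>C x + a *\<^sub>C y"
    and scaleC_add_left: "(a + b) *\<^sub>C x = a *\<^sub>C x + b *\<^sub>C x"
    and scaleC_scaleC: "a *\<^sub>C (b *\<^sub>C x) = (a * b) *\<^sub>C x"
    and scaleC_one: "1 *\<^sub>C x = x"

global_interpretation complex_vector: vector_space "scaleC :: complex \<Rightarrow> 'a \<Rightarrow> 'a::complex_vector"
  by unfold_locales (simp_all add: scaleC_add_right scaleC_add_left scaleC_scaleC scaleC_one)

text \<open>Associative and unital, not necessarily commutative; the zero algebra is allowed.\<close>

class complex_algebra = complex_vector + ring + monoid_mult +
  assumes mult_scaleC_left: "(a *\<^sub>C x) * y = a *\<^sub>C (x * y)"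
    and mult_scaleC_right: "x * (a *\<^sub>C y) = a *\<^sub>C (x * y)"

abbreviation clinear :: "('a::complex_vector \<Rightarrow> 'b::complex_vector) \<Rightarrow> bool"
  where "clinear \<equiv> Vector_Spaces.linear scaleC scaleC"

lemma clinearI:
  assumes "\<And>x y. f (x + y) = f x + f y" and "\<And>c x. f (c *\<^sub>C x) = c *\<^sub>C f x"
  shows "clinear f"
  using assms by unfold_locales auto

lemma clinear_add: "clinear f \<Longrightarrow> f (x + y) = f x + f y"
  and clinear_scaleC: "clinear f \<Longrightarrow> f (c *\<^sub>C x) = c *\<^sub>C f x"
  by (simp_all add: Vector_Spaces.linear_iff)

definition algebra_hom :: "('a::complex_algebra \<Rightarrow> 'b::complex_algebra) \<Rightarrow> bool"
  where "algebra_hom f \<longleftrightarrow> clinear f \<and> f 1 = 1 \<and> (\<forall>x y. f (x * y) = f x * f y)"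

instantiation complex :: complex_algebra
begin
definition scaleC_complex :: "complex \<Rightarrow> complex \<Rightarrow> complex" where "scaleC_complex = (*)"
instance by standard (simp_all add: scaleC_complex_def algebra_simps)
end

instantiation "fun" :: (type, complex_vector) complex_vector
begin
definition scaleC_fun :: "complex \<Rightarrow> ('a \<Rightarrow> 'b) \<Rightarrow> 'a \<Rightarrow> 'b" where "scaleC_fun c f = (\<lambda>x. c *\<^sub>C f x)"
instance
  by standard
    (simp_all add: scaleC_fun_def fun_eq_iff scaleC_add_right scaleC_add_left scaleC_scaleC scaleC_one)
end


section \<open>Tensor products over the complex numbers\<close>

text \<open>
  The tensor product is presented by generators and relations: formal linear expressions in the pure
  tensors, modulo the least congruence containing the vector space axioms and bilinearity. Zero and
  negation need no constructors, as they are given by \<open>0 \<otimes> 0\<close> and by scaling with \<open>-1\<close>.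
\<close>

datatype ('a, 'b) tensor_term =
    TPure 'a 'b
  | TAdd "('a, 'b) tensor_term" "('a, 'b) tensor_term"
  | TScale complex "('a, 'b) tensor_term"

inductive tensor_eq ::
  "('a::complex_vector, 'b::complex_vector) tensor_term \<Rightarrow> ('a, 'b) tensor_term \<Rightarrow> bool"
where
  refl: "tensor_eq s s"
| sym: "tensor_eq s t \<Longrightarrow> tensor_eq t s"
| trans: "tensor_eq s t \<Longrightarrow> tensor_eq t u \<Longrightarrow> tensor_eq s u"
| cong_add: "tensor_eq s s' \<Longrightarrow> tensor_eq t t' \<Longrightarrow> tensor_eq (TAdd s t) (TAdd s' t')"
| cong_scale: "tensor_eq s s' \<Longrightarrow> tensor_eq (TScale c s) (TScale c s')"
| add_assoc: "tensor_eq (TAdd (TAdd s t) u) (TAdd s (TAdd t u))"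
| add_commute: "tensor_eq (TAdd s t) (TAdd t s)"
| add_zero: "tensor_eq (TAdd (TPure 0 0) s) s"
| add_minus: "tensor_eq (TAdd (TScale (-1) s) s) (TPure 0 0)"
| scale_add_right: "tensor_eq (TScale c (TAdd s t)) (TAdd (TScale c s) (TScale c t))"
| scale_add_left: "tensor_eq (TScale (c + d) s) (TAdd (TScale c s) (TScale d s))"
| scale_scale: "tensor_eq (TScale c (TScale d s)) (TScale (c * d) s)"
| scale_one: "tensor_eq (TScale 1 s) s"
| pure_add_left: "tensor_eq (TPure (a + a') b) (TAdd (TPure a b) (TPure a' b))"
| pure_add_right: "tensor_eq (TPure a (b + b')) (TAdd (TPure a b) (TPure a b'))"
| pure_scale_left: "tensor_eq (TPure (c *\<^sub>C a) b) (TScale c (TPure a b))"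
| pure_scale_right: "tensor_eq (TPure a (c *\<^sub>C b)) (TScale c (TPure a b))"

quotient_type (overloaded) ('a, 'b) tensor =
  "('a::complex_vector, 'b::complex_vector) tensor_term" / tensor_eq
  by (rule equivpI)
    (auto intro!: reflpI sympI transpI intro: tensor_eq.refl tensor_eq.sym tensor_eq.trans)

lift_definition tensor_pure ::
  "'a::complex_vector \<Rightarrow> 'b::complex_vector \<Rightarrow> ('a, 'b) tensor" (infixr "\<otimes>" 76)
  is TPure .

instantiation tensor :: (complex_vector, complex_vector) complex_vector
begin
lift_definition plus_tensor :: "('a, 'b) tensor \<Rightarrow> ('a, 'b) tensor \<Rightarrow> ('a, 'b) tensor"
  is TAdd by (rule tensor_eq.cong_add)
lift_definition scaleC_tensor :: "complex \<Rightarrow> ('a, 'b) tensor \<Rightarrow> ('a, 'b) tensor"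
  is TScale by (rule tensor_eq.cong_scale)
lift_definition zero_tensor :: "('a, 'b) tensor" is "TPure 0 0" .
definition uminus_tensor :: "('a, 'b) tensor \<Rightarrow> ('a, 'b) tensor"
  where "uminus_tensor x = (-1) *\<^sub>C x"
definition minus_tensor :: "('a, 'b) tensor \<Rightarrow> ('a, 'b) tensor \<Rightarrow> ('a, 'b) tensor"
  where "minus_tensor x y = x + (- y)"
instance
proof
  fix x y z :: "('a, 'b) tensor" and c d :: complex
  show "x + y + z = x + (y + z)" by transfer (rule tensor_eq.add_assoc)
  show "x + y = y + x" by transfer (rule tensor_eq.add_commute)
  show "0 + x = x" by transfer (rule tensor_eq.add_zero)
  show "- x + x = 0" unfolding uminus_tensor_def by transfer (rule tensor_eq.add_minus)
  show "x - y = x + (- y)" by (rule minus_tensor_def)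
  show "c *\<^sub>C (x + y) = c *\<^sub>C x + c *\<^sub>C y" by transfer (rule tensor_eq.scale_add_right)
  show "(c + d) *\<^sub>C x = c *\<^sub>C x + d *\<^sub>C x" by transfer (rule tensor_eq.scale_add_left)
  show "c *\<^sub>C (d *\<^sub>C x) = (c * d) *\<^sub>C x" by transfer (rule tensor_eq.scale_scale)
  show "1 *\<^sub>C x = x" by transfer (rule tensor_eq.scale_one)
qed
end

lemma tensor_pure_add_left: "(a + a') \<otimes> b = a \<otimes> b + a' \<otimes> b"
  by transfer (rule tensor_eq.pure_add_left)

lemma tensor_pure_add_right: "a \<otimes> (b + b') = a \<otimes> b + a \<otimes> b'"
  by transfer (rule tensor_eq.pure_add_right)

lemma tensor_pure_scaleC_left: "(c *\<^sub>C a) \<otimes> b = c *\<^sub>C (a \<otimes> b)"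
  by transfer (rule tensor_eq.pure_scale_left)

lemma tensor_pure_scaleC_right: "a \<otimes> (c *\<^sub>C b) = c *\<^sub>C (a \<otimes> b)"
  by transfer (rule tensor_eq.pure_scale_right)

lemma tensor_induct [case_names pure add scale]:
  assumes "\<And>a b. P (a \<otimes> b)"
    and "\<And>x y. P x \<Longrightarrow> P y \<Longrightarrow> P (x + y)"
    and "\<And>c x. P x \<Longrightarrow> P (c *\<^sub>C x)"
  shows "P x"
proof -
  have "P (abs_tensor t)" for t
  proof (induction t)
    case (TPure a b)
    then show ?case using assms(1)[of a b] by (simp add: tensor_pure.abs_eq)
  next
    case (TAdd s t)
    then show ?case using assms(2)[OF TAdd] by (simp add: plus_tensor.abs_eq)
  next
    case (TScale c t)
    then show ?case using assms(3)[OF TScale, of c] by (simp add: scaleC_tensor.abs_eq)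
  qed
  then show ?thesis by (induction x rule: tensor.abs_induct)
qed

definition bilinear_map ::
  "('a::complex_vector \<Rightarrow> 'b::complex_vector \<Rightarrow> 'c::complex_vector) \<Rightarrow> bool"
  where "bilinear_map \<beta> \<longleftrightarrow> (\<forall>b. clinear (\<lambda>a. \<beta> a b)) \<and> (\<forall>a. clinear (\<beta> a))"

lemma bilinear_mapI:
  assumes "\<And>a a' b. \<beta> (a + a') b = \<beta> a b + \<beta> a' b" and "\<And>c a b. \<beta> (c *\<^sub>C a) b = c *\<^sub>C \<beta> a b"
    and "\<And>a b b'. \<beta> a (b + b') = \<beta> a b + \<beta> a b'" and "\<And>c a b. \<beta> a (c *\<^sub>C b) = c *\<^sub>C \<beta> a b"
  shows "bilinear_map \<beta>"
  unfolding bilinear_map_def using assms by (auto intro!: clinearI)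

primrec tensor_term_eval ::
  "('a \<Rightarrow> 'b \<Rightarrow> 'c::complex_vector) \<Rightarrow> ('a, 'b) tensor_term \<Rightarrow> 'c"
where
  "tensor_term_eval \<beta> (TPure a b) = \<beta> a b"
| "tensor_term_eval \<beta> (TAdd s t) = tensor_term_eval \<beta> s + tensor_term_eval \<beta> t"
| "tensor_term_eval \<beta> (TScale c t) = c *\<^sub>C tensor_term_eval \<beta> t"

text \<open>The linear map induced by a bilinear map; meaningful only for bilinear \<open>\<beta>\<close>.\<close>

definition tensor_lift ::
  "('a::complex_vector \<Rightarrow> 'b::complex_vector \<Rightarrow> 'c::complex_vector) \<Rightarrow> ('a, 'b) tensor \<Rightarrow> 'c"
  where "tensor_lift \<beta> x = tensor_term_eval \<beta> (rep_tensor x)"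

lemma tensor_term_eval_cong:
  assumes "bilinear_map \<beta>" and "tensor_eq s t"
  shows "tensor_term_eval \<beta> s = tensor_term_eval \<beta> t"
proof -
  have lin: "\<beta> (a + a') b = \<beta> a b + \<beta> a' b" "\<beta> a (b + b') = \<beta> a b + \<beta> a b'"
    "\<beta> (c *\<^sub>C a) b = c *\<^sub>C \<beta> a b" "\<beta> a (c *\<^sub>C b) = c *\<^sub>C \<beta> a b" for a a' b b' c
    using assms(1) by (auto simp: bilinear_map_def Vector_Spaces.linear_iff)
  have "\<beta> 0 0 = 0" using lin(3)[of 0 0 0] by simp
  with assms(2) show ?thesis
    by (induction rule: tensor_eq.induct)
      (simp_all add: lin scaleC_add_left scaleC_add_right scaleC_scaleC scaleC_one algebra_simps)
qed

lemma tensor_lift_abs: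
  assumes "bilinear_map \<beta>"
  shows "tensor_lift \<beta> (abs_tensor t) = tensor_term_eval \<beta> t"
  unfolding tensor_lift_def
  using tensor_term_eval_cong[OF assms] Quotient3_rep_abs[OF Quotient3_tensor] tensor_eq.refl
  by metis

lemma tensor_lift_pure: "bilinear_map \<beta> \<Longrightarrow> tensor_lift \<beta> (a \<otimes> b) = \<beta> a b"
  by (simp add: tensor_pure.abs_eq tensor_lift_abs)

lemma tensor_lift_add:
  "bilinear_map \<beta> \<Longrightarrow> tensor_lift \<beta> (x + y) = tensor_lift \<beta> x + tensor_lift \<beta> y"
  by (induction x rule: tensor.abs_induct, induction y rule: tensor.abs_induct) (simp add: plus_tensor.abs_eq tensor_lift_abs)

lemma tensor_lift_scaleC:
  "bilinear_map \<beta> \<Longrightarrow> tensor_lift \<beta> (c *\<^sub>C x) = c *\<^sub>C tensor_lift \<beta> x"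
  by (induction x rule: tensor.abs_induct) (simp add: scaleC_tensor.abs_eq tensor_lift_abs)

lemmas tensor_lift_simps = tensor_lift_pure tensor_lift_add tensor_lift_scaleC

definition tensor_map ::
  "('a::complex_vector \<Rightarrow> 'c::complex_vector) \<Rightarrow> ('b::complex_vector \<Rightarrow> 'd::complex_vector)
    \<Rightarrow> ('a, 'b) tensor \<Rightarrow> ('c, 'd) tensor"
  where "tensor_map f g = tensor_lift (\<lambda>a b. f a \<otimes> g b)"

definition tensor_assoc ::
  "(('a::complex_vector, 'b::complex_vector) tensor, 'c::complex_vector) tensor
    \<Rightarrow> ('a, ('b, 'c) tensor) tensor"
  where "tensor_assoc = tensor_lift (\<lambda>x c. tensor_lift (\<lambda>a b. a \<otimes> (b \<otimes> c)) x)"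

subsection \<open>The tensor product algebra\<close>

instantiation tensor :: (complex_algebra, complex_algebra) complex_algebra
begin
definition one_tensor :: "('a, 'b) tensor" where "one_tensor = 1 \<otimes> 1"
definition times_tensor :: "('a, 'b) tensor \<Rightarrow> ('a, 'b) tensor \<Rightarrow> ('a, 'b) tensor"
  where "times_tensor x y = tensor_lift (\<lambda>a b. tensor_lift (\<lambda>c d. (a * c) \<otimes> (b * d)) y) x"
instance
proof
  have bil1: "bilinear_map (\<lambda>c d. (a * c) \<otimes> (b * d))" for a :: 'a and b :: 'b
    by (rule bilinear_mapI)
      (simp_all add: distrib_left mult_scaleC_right tensor_pure_add_left tensor_pure_add_right
        tensor_pure_scaleC_left tensor_pure_scaleC_right)
  define m where "m a b = tensor_lift (\<lambda>c d. (a * c) \<otimes> (b * d))" for a :: 'a and b :: 'b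
  have m: "m a b (c \<otimes> d) = (a * c) \<otimes> (b * d)" "m a b (x + y) = m a b x + m a b y"
    "m a b (k *\<^sub>C x) = k *\<^sub>C m a b x" for a b c d x y k
    by (simp_all add: m_def tensor_lift_simps[OF bil1])
  have m_left: "m (a + a') b y = m a b y + m a' b y" "m a (b + b') y = m a b y + m a b' y"
    "m (k *\<^sub>C a) b y = k *\<^sub>C m a b y" "m a (k *\<^sub>C b) y = k *\<^sub>C m a b y" for a a' b b' y k
    by (induction y rule: tensor_induct)
      (simp_all add: m distrib_right mult_scaleC_left tensor_pure_add_left
        tensor_pure_add_right tensor_pure_scaleC_left tensor_pure_scaleC_right
        scaleC_add_right mult.commute add_ac)
  have times: "x * y = tensor_lift (\<lambda>a b. m a b y) x" for x y :: "('a, 'b) tensor"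
    by (simp add: times_tensor_def m_def)
  have bil2: "bilinear_map (\<lambda>a b. m a b y)" for y
    by (rule bilinear_mapI) (rule m_left)+
  have pm: "(a \<otimes> b) * y = m a b y" for a :: 'a and b :: 'b and y
    by (simp add: times tensor_lift_pure[OF bil2])
  have pp: "(a \<otimes> b) * (c \<otimes> d) = (a * c) \<otimes> (b * d)" for a c :: 'a and b d :: 'b
    by (simp add: pm m)
  have al: "(x + y) * z = x * z + y * z" for x y z :: "('a, 'b) tensor"
    by (simp add: times tensor_lift_add[OF bil2])
  have sl: "(c *\<^sub>C x) * z = c *\<^sub>C (x * z)" for c and x z :: "('a, 'b) tensor"
    by (simp add: times tensor_lift_scaleC[OF bil2])
  have ar: "x * (y + z) = x * y + x * z" for x y z :: "('a, 'b) tensor"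
    by (induction x rule: tensor_induct)
      (simp_all add: pm m al sl scaleC_add_right add_ac)
  have sr: "x * (c *\<^sub>C z) = c *\<^sub>C (x * z)" for c and x z :: "('a, 'b) tensor"
    by (induction x rule: tensor_induct)
      (simp_all add: pm m al sl scaleC_add_right mult.commute)
  have ppz: "(a \<otimes> b) * ((c \<otimes> d) * z) = ((a * c) \<otimes> (b * d)) * z"
    for a c :: 'a and b d :: 'b and z :: "('a, 'b) tensor"
    by (induction z rule: tensor_induct) (simp_all add: pp ar sr mult.assoc)
  have pyz: "(a \<otimes> b) * (y * z) = ((a \<otimes> b) * y) * z" for a :: 'a and b :: 'b and y z :: "('a, 'b) tensor"
    by (induction y rule: tensor_induct) (simp_all add: ppz pp al ar sl sr)
  fix x y z :: "('a, 'b) tensor" and c :: complex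
  show "(x + y) * z = x * z + y * z" by (rule al)
  show "x * (y + z) = x * y + x * z" by (rule ar)
  show "(c *\<^sub>C x) * y = c *\<^sub>C (x * y)" by (rule sl)
  show "x * (c *\<^sub>C y) = c *\<^sub>C (x * y)" by (rule sr)
  show "x * y * z = x * (y * z)"
    by (induction x rule: tensor_induct) (simp_all add: pyz al sl)
  show "1 * x = x"
    by (induction x rule: tensor_induct) (simp_all add: ar sr, simp add: one_tensor_def pp)
  show "x * 1 = x"
    by (induction x rule: tensor_induct) (simp_all add: al sl, simp add: one_tensor_def pp)
qed
end


section \<open>Hopf algebras\<close>

text \<open>
  Comultiplication \<open>\<Delta>\<close>, counit \<open>\<epsilon>\<close> and antipode \<open>S\<close> on the algebra \<open>'a\<close>. The canonical identifications
  \<open>\<complex> \<otimes> A = A = A \<otimes> \<complex>\<close> are absorbed into the counit axioms.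
\<close>

locale hopf_algebra =
  fixes \<Delta> :: "'a::complex_algebra \<Rightarrow> ('a, 'a) tensor"
    and \<epsilon> :: "'a \<Rightarrow> complex"
    and S :: "'a \<Rightarrow> 'a"
  assumes comult_hom: "algebra_hom \<Delta>"
    and counit_hom: "algebra_hom \<epsilon>"
    and coassoc: "tensor_assoc (tensor_map \<Delta> id (\<Delta> a)) = tensor_map id \<Delta> (\<Delta> a)"
    and counit_left: "tensor_lift (\<lambda>x y. \<epsilon> x *\<^sub>C y) (\<Delta> a) = a"
    and counit_right: "tensor_lift (\<lambda>x y. \<epsilon> y *\<^sub>C x) (\<Delta> a) = a"
    and antipode_linear: "clinear S"
    and antipode_left: "tensor_lift (\<lambda>x y. S x * y) (\<Delta> a) = \<epsilon> a *\<^sub>C 1"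
    and antipode_right: "tensor_lift (\<lambda>x y. x * S y) (\<Delta> a) = \<epsilon> a *\<^sub>C 1"


section \<open>The free product of two unital algebras\<close>

text \<open>
  The coproduct in the category of unital complex algebras, presented by generators and relations:
  formal algebra expressions in the elements of the two algebras, modulo the least congruence that
  contains the algebra axioms and makes both inclusions of generators homomorphisms of unital
  algebras. Its zero is the class of \<open>FInl 0\<close> and its unit the class of \<open>FInl 1\<close>. The Hopf structure
  that the free product of two Hopf algebras carries is not defined here, since Hochschild cohomology
  depends on the underlying algebra only.
\<close>

datatype ('a, 'b) fp_term =
    FInl 'a
  | FInr 'b
  | FAdd "('a, 'b) fp_term" "('a, 'b) fp_term"
  | FMult "('a, 'b) fp_term" "('a, 'b) fp_term"
  | FScale complex "('a, 'b) fp_term"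

inductive fp_eq ::
  "('a::complex_algebra, 'b::complex_algebra) fp_term \<Rightarrow> ('a, 'b) fp_term \<Rightarrow> bool"
where
  refl: "fp_eq s s"
| sym: "fp_eq s t \<Longrightarrow> fp_eq t s"
| trans: "fp_eq s t \<Longrightarrow> fp_eq t u \<Longrightarrow> fp_eq s u"
| cong_add: "fp_eq s s' \<Longrightarrow> fp_eq t t' \<Longrightarrow> fp_eq (FAdd s t) (FAdd s' t')"
| cong_mult: "fp_eq s s' \<Longrightarrow> fp_eq t t' \<Longrightarrow> fp_eq (FMult s t) (FMult s' t')"
| cong_scale: "fp_eq s s' \<Longrightarrow> fp_eq (FScale c s) (FScale c s')"
| add_assoc: "fp_eq (FAdd (FAdd s t) u) (FAdd s (FAdd t u))"
| add_commute: "fp_eq (FAdd s t) (FAdd t s)"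
| add_zero: "fp_eq (FAdd (FInl 0) s) s"
| add_minus: "fp_eq (FAdd (FScale (-1) s) s) (FInl 0)"
| scale_add_right: "fp_eq (FScale c (FAdd s t)) (FAdd (FScale c s) (FScale c t))"
| scale_add_left: "fp_eq (FScale (c + d) s) (FAdd (FScale c s) (FScale d s))"
| scale_scale: "fp_eq (FScale c (FScale d s)) (FScale (c * d) s)"
| scale_one: "fp_eq (FScale 1 s) s"
| mult_assoc: "fp_eq (FMult (FMult s t) u) (FMult s (FMult t u))"
| mult_one_left: "fp_eq (FMult (FInl 1) s) s"
| mult_one_right: "fp_eq (FMult s (FInl 1)) s"
| distrib_right: "fp_eq (FMult (FAdd s t) u) (FAdd (FMult s u) (FMult t u))"
| distrib_left: "fp_eq (FMult s (FAdd t u)) (FAdd (FMult s t) (FMult s u))"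
| scale_mult_left: "fp_eq (FMult (FScale c s) t) (FScale c (FMult s t))"
| scale_mult_right: "fp_eq (FMult s (FScale c t)) (FScale c (FMult s t))"
| inl_add: "fp_eq (FInl (a + a')) (FAdd (FInl a) (FInl a'))"
| inl_scale: "fp_eq (FInl (c *\<^sub>C a)) (FScale c (FInl a))"
| inl_mult: "fp_eq (FInl (a * a')) (FMult (FInl a) (FInl a'))"
| inr_add: "fp_eq (FInr (b + b')) (FAdd (FInr b) (FInr b'))"
| inr_scale: "fp_eq (FInr (c *\<^sub>C b)) (FScale c (FInr b))"
| inr_mult: "fp_eq (FInr (b * b')) (FMult (FInr b) (FInr b'))"
| inr_one: "fp_eq (FInr 1) (FInl 1)"

quotient_type (overloaded) ('a, 'b) free_product =
  "('a::complex_algebra, 'b::complex_algebra) fp_term" / fp_eq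
  by (rule equivpI) (auto intro!: reflpI sympI transpI intro: fp_eq.refl fp_eq.sym fp_eq.trans)

lift_definition fp_inl :: "'a::complex_algebra \<Rightarrow> ('a, 'b::complex_algebra) free_product" is FInl .
lift_definition fp_inr :: "'b::complex_algebra \<Rightarrow> ('a::complex_algebra, 'b) free_product" is FInr .

instantiation free_product :: (complex_algebra, complex_algebra) complex_algebra
begin
lift_definition plus_free_product ::
  "('a, 'b) free_product \<Rightarrow> ('a, 'b) free_product \<Rightarrow> ('a, 'b) free_product"
  is FAdd by (rule fp_eq.cong_add)
lift_definition times_free_product ::
  "('a, 'b) free_product \<Rightarrow> ('a, 'b) free_product \<Rightarrow> ('a, 'b) free_product"
  is FMult by (rule fp_eq.cong_mult)
lift_definition scaleC_free_product :: "complex \<Rightarrow> ('a, 'b) free_product \<Rightarrow> ('a, 'b) free_product"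
  is FScale by (rule fp_eq.cong_scale)
lift_definition zero_free_product :: "('a, 'b) free_product" is "FInl 0" .
lift_definition one_free_product :: "('a, 'b) free_product" is "FInl 1" .
definition uminus_free_product :: "('a, 'b) free_product \<Rightarrow> ('a, 'b) free_product"
  where "uminus_free_product x = (-1) *\<^sub>C x"
definition minus_free_product ::
  "('a, 'b) free_product \<Rightarrow> ('a, 'b) free_product \<Rightarrow> ('a, 'b) free_product"
  where "minus_free_product x y = x + (- y)"
instance
proof
  fix x y z :: "('a, 'b) free_product" and c d :: complex
  show "x + y + z = x + (y + z)" by transfer (rule fp_eq.add_assoc)
  show "x + y = y + x" by transfer (rule fp_eq.add_commute)
  show "0 + x = x" by transfer (rule fp_eq.add_zero)
  show "- x + x = 0" unfolding uminus_free_product_def by transfer (rule fp_eq.add_minus)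
  show "x - y = x + (- y)" by (rule minus_free_product_def)
  show "c *\<^sub>C (x + y) = c *\<^sub>C x + c *\<^sub>C y" by transfer (rule fp_eq.scale_add_right)
  show "(c + d) *\<^sub>C x = c *\<^sub>C x + d *\<^sub>C x" by transfer (rule fp_eq.scale_add_left)
  show "c *\<^sub>C (d *\<^sub>C x) = (c * d) *\<^sub>C x" by transfer (rule fp_eq.scale_scale)
  show "1 *\<^sub>C x = x" by transfer (rule fp_eq.scale_one)
  show "x * y * z = x * (y * z)" by transfer (rule fp_eq.mult_assoc)
  show "1 * x = x" by transfer (rule fp_eq.mult_one_left)
  show "x * 1 = x" by transfer (rule fp_eq.mult_one_right)
  show "(x + y) * z = x * z + y * z" by transfer (rule fp_eq.distrib_right)
  show "x * (y + z) = x * y + x * z" by transfer (rule fp_eq.distrib_left)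
  show "(c *\<^sub>C x) * y = c *\<^sub>C (x * y)" by transfer (rule fp_eq.scale_mult_left)
  show "x * (c *\<^sub>C y) = c *\<^sub>C (x * y)" by transfer (rule fp_eq.scale_mult_right)
qed
end

lemma algebra_hom_fp_inl: "algebra_hom fp_inl"
  unfolding algebra_hom_def
proof (intro conjI allI clinearI)
  show "fp_inl (x + y) = fp_inl x + fp_inl y" for x y by transfer (rule fp_eq.inl_add)
  show "fp_inl (c *\<^sub>C x) = c *\<^sub>C fp_inl x" for c x by transfer (rule fp_eq.inl_scale)
  show "fp_inl 1 = 1" by transfer (rule fp_eq.refl)
  show "fp_inl (x * y) = fp_inl x * fp_inl y" for x y by transfer (rule fp_eq.inl_mult)
qed

lemma algebra_hom_fp_inr: "algebra_hom fp_inr"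
  unfolding algebra_hom_def
proof (intro conjI allI clinearI)
  show "fp_inr (x + y) = fp_inr x + fp_inr y" for x y by transfer (rule fp_eq.inr_add)
  show "fp_inr (c *\<^sub>C x) = c *\<^sub>C fp_inr x" for c x by transfer (rule fp_eq.inr_scale)
  show "fp_inr 1 = 1" by transfer (rule fp_eq.inr_one)
  show "fp_inr (x * y) = fp_inr x * fp_inr y" for x y by transfer (rule fp_eq.inr_mult)
qed

lemma free_product_induct [case_names inl inr add mult scale]:
  assumes "\<And>a. P (fp_inl a)" and "\<And>b. P (fp_inr b)"
    and "\<And>x y. P x \<Longrightarrow> P y \<Longrightarrow> P (x + y)"
    and "\<And>x y. P x \<Longrightarrow> P y \<Longrightarrow> P (x * y)"
    and "\<And>c x. P x \<Longrightarrow> P (c *\<^sub>C x)"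
  shows "P x"
proof -
  have "P (abs_free_product t)" for t
  proof (induction t)
    case (FInl a)
    then show ?case using assms(1)[of a] by (simp add: fp_inl.abs_eq)
  next
    case (FInr b)
    then show ?case using assms(2)[of b] by (simp add: fp_inr.abs_eq)
  next
    case (FAdd s t)
    then show ?case using assms(3)[OF FAdd] by (simp add: plus_free_product.abs_eq)
  next
    case (FMult s t)
    then show ?case using assms(4)[OF FMult] by (simp add: times_free_product.abs_eq)
  next
    case (FScale c t)
    then show ?case using assms(5)[OF FScale, of c] by (simp add: scaleC_free_product.abs_eq)
  qed
  then show ?thesis by (induction x rule: free_product.abs_induct)
qed

primrec fp_term_eval ::
  "('a \<Rightarrow> 'c::complex_algebra) \<Rightarrow> ('b \<Rightarrow> 'c) \<Rightarrow> ('a, 'b) fp_term \<Rightarrow> 'c"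
where
  "fp_term_eval f g (FInl a) = f a"
| "fp_term_eval f g (FInr b) = g b"
| "fp_term_eval f g (FAdd s t) = fp_term_eval f g s + fp_term_eval f g t"
| "fp_term_eval f g (FMult s t) = fp_term_eval f g s * fp_term_eval f g t"
| "fp_term_eval f g (FScale c t) = c *\<^sub>C fp_term_eval f g t"

lemma fp_term_eval_cong:
  fixes f :: "'a::complex_algebra \<Rightarrow> 'c::complex_algebra" and g :: "'b::complex_algebra \<Rightarrow> 'c"
  assumes "algebra_hom f" and "algebra_hom g" and "fp_eq s t"
  shows "fp_term_eval f g s = fp_term_eval f g t"
proof -
  have f: "f (a + a') = f a + f a'" "f (c *\<^sub>C a) = c *\<^sub>C f a" "f (a * a') = f a * f a'" "f 1 = 1"
    and g: "g (b + b') = g b + g b'" "g (c *\<^sub>C b) = c *\<^sub>C g b" "g (b * b') = g b * g b'" "g 1 = 1"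
    for a a' b b' c
    using assms(1,2) by (auto simp: algebra_hom_def Vector_Spaces.linear_iff)
  have "f 0 = 0" using f(2)[of 0 0] by simp
  with assms(3) show ?thesis
    by (induction rule: fp_eq.induct)
      (simp_all add: f g scaleC_add_left scaleC_add_right scaleC_scaleC scaleC_one
        mult_scaleC_left mult_scaleC_right algebra_simps)
qed

theorem free_product_universal:
  fixes f :: "'a::complex_algebra \<Rightarrow> 'c::complex_algebra" and g :: "'b::complex_algebra \<Rightarrow> 'c"
  assumes "algebra_hom f" and "algebra_hom g"
  shows "\<exists>!h. algebra_hom h \<and> h \<circ> fp_inl = f \<and> h \<circ> fp_inr = g"
proof (rule ex_ex1I)
  define h where "h x = fp_term_eval f g (rep_free_product x)" for x
  have h: "h (abs_free_product t) = fp_term_eval f g t" for t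
    unfolding h_def
    using fp_term_eval_cong[OF assms] Quotient3_rep_abs[OF Quotient3_free_product] fp_eq.refl by metis
  have "h (x + y) = h x + h y" for x y
    by (induction x rule: free_product.abs_induct, induction y rule: free_product.abs_induct)
      (simp add: plus_free_product.abs_eq h)
  moreover have "h (x * y) = h x * h y" for x y
    by (induction x rule: free_product.abs_induct, induction y rule: free_product.abs_induct)
      (simp add: times_free_product.abs_eq h)
  moreover have "h (c *\<^sub>C x) = c *\<^sub>C h x" for c x
    by (induction x rule: free_product.abs_induct) (simp add: scaleC_free_product.abs_eq h)
  moreover have "h 1 = 1"
    using assms(1) by (simp add: one_free_product.abs_eq h algebra_hom_def)
  moreover have "h \<circ> fp_inl = f" "h \<circ> fp_inr = g"
    by (simp_all add: fun_eq_iff fp_inl.abs_eq fp_inr.abs_eq h)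
  ultimately show "\<exists>h. algebra_hom h \<and> h \<circ> fp_inl = f \<and> h \<circ> fp_inr = g"
    unfolding algebra_hom_def by (intro exI[of _ h] conjI allI clinearI)
next
  fix h k
  assume h: "algebra_hom h \<and> h \<circ> fp_inl = f \<and> h \<circ> fp_inr = g"
    and k: "algebra_hom k \<and> k \<circ> fp_inl = f \<and> k \<circ> fp_inr = g"
  have "h x = k x" for x
  proof (induction x rule: free_product_induct)
    case (inl a)
    from h k show ?case by (metis comp_apply)
  next
    case (inr b)
    from h k show ?case by (metis comp_apply)
  qed (use h k in \<open>simp_all add: algebra_hom_def clinear_add clinear_scaleC\<close>)
  then show "h = k" by (rule ext)
qed


section \<open>Bimodules\<close>

text \<open>
  The underlying vector space of a bimodule is a linear subspace \<open>carr M\<close> of an ambient complex vector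
  space \<open>'m\<close>, so that one can quantify over all bimodules (of varying size) inside a formula. Every
  bimodule arises in this way, for instance with \<open>carr M = UNIV\<close>. The actions matter on \<open>carr M\<close> only;
  scalars act centrally by bilinearity of both actions.
\<close>

record ('a, 'm) bimod =
  carr :: "'m set"
  lact :: "'a \<Rightarrow> 'm \<Rightarrow> 'm"
  ract :: "'m \<Rightarrow> 'a \<Rightarrow> 'm"

definition bimodule :: "('a::complex_algebra, 'm::complex_vector) bimod \<Rightarrow> bool"
  where "bimodule M \<longleftrightarrow>
    complex_vector.subspace (carr M) \<and>
    (\<forall>a. \<forall>m\<in>carr M. lact M a m \<in> carr M \<and> ract M m a \<in> carr M) \<and>
    (\<forall>m\<in>carr M. clinear (\<lambda>a. lact M a m) \<and> clinear (ract M m)) \<and>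
    (\<forall>a. \<forall>m\<in>carr M. \<forall>m'\<in>carr M.
      lact M a (m + m') = lact M a m + lact M a m' \<and> ract M (m + m') a = ract M m a + ract M m' a) \<and>
    (\<forall>a c. \<forall>m\<in>carr M.
      lact M a (c *\<^sub>C m) = c *\<^sub>C lact M a m \<and> ract M (c *\<^sub>C m) a = c *\<^sub>C ract M m a) \<and>
    (\<forall>m\<in>carr M. lact M 1 m = m \<and> ract M m 1 = m) \<and>
    (\<forall>a b. \<forall>m\<in>carr M.
      lact M (a * b) m = lact M a (lact M b m) \<and>
      ract M m (a * b) = ract M (ract M m a) b \<and>
      lact M a (ract M m b) = ract M (lact M a m) b)"

definition bimodule_hom ::
  "('a::complex_algebra, 'm::complex_vector) bimod \<Rightarrow> ('a, 'n::complex_vector) bimod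
    \<Rightarrow> ('m \<Rightarrow> 'n) \<Rightarrow> bool"
  where "bimodule_hom M N f \<longleftrightarrow>
    (\<forall>m\<in>carr M. f m \<in> carr N) \<and>
    (\<forall>m\<in>carr M. \<forall>m'\<in>carr M. f (m + m') = f m + f m') \<and>
    (\<forall>c. \<forall>m\<in>carr M. f (c *\<^sub>C m) = c *\<^sub>C f m) \<and>
    (\<forall>a. \<forall>m\<in>carr M. f (lact M a m) = lact N a (f m) \<and> f (ract M m a) = ract N (f m) a)"

definition restrict_bimodule :: "('a \<Rightarrow> 'b) \<Rightarrow> ('b, 'm) bimod \<Rightarrow> ('a, 'm) bimod"
  where "restrict_bimodule h M =
    \<lparr>carr = carr M, lact = (\<lambda>a. lact M (h a)), ract = (\<lambda>m a. ract M m (h a))\<rparr>"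


section \<open>Hochschild cohomology\<close>

record 'v vspace =
  vcarr :: "'v set"
  vadd :: "'v \<Rightarrow> 'v \<Rightarrow> 'v"
  vscale :: "complex \<Rightarrow> 'v \<Rightarrow> 'v"

definition quotient_space :: "'v::complex_vector set \<Rightarrow> 'v set \<Rightarrow> 'v set vspace"
  where "quotient_space Z B =
    \<lparr>vcarr = (\<lambda>z. z +o B) ` Z, vadd = (\<lambda>X Y. X + Y), vscale = (\<lambda>c X. scaleC c ` X + B)\<rparr>"

definition direct_sum :: "'v vspace \<Rightarrow> 'w vspace \<Rightarrow> ('v \<times> 'w) vspace"
  where "direct_sum V W =
    \<lparr>vcarr = vcarr V \<times> vcarr W,
     vadd = (\<lambda>(v, w) (v', w'). (vadd V v v', vadd W w w')),
     vscale = (\<lambda>c (v, w). (vscale V c v, vscale W c w))\<rparr>"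

definition linear_iso :: "'v vspace \<Rightarrow> 'w vspace \<Rightarrow> ('v \<Rightarrow> 'w) \<Rightarrow> bool"
  where "linear_iso V W \<phi> \<longleftrightarrow>
    bij_betw \<phi> (vcarr V) (vcarr W) \<and>
    (\<forall>x\<in>vcarr V. \<forall>y\<in>vcarr V. \<phi> (vadd V x y) = vadd W (\<phi> x) (\<phi> y)) \<and>
    (\<forall>c. \<forall>x\<in>vcarr V. \<phi> (vscale V c x) = vscale W c (\<phi> x))"

text \<open>
  The \<open>n\<close>-cochains are the \<open>n\<close>-linear maps \<open>A\<^sup>n \<rightarrow> M\<close>. The arguments are collected in a list of length
  \<open>n\<close>; a cochain is \<open>0\<close> by convention on lists of any other length.
\<close>

definition cochains ::
  "nat \<Rightarrow> ('a::complex_algebra, 'm::complex_vector) bimod \<Rightarrow> ('a list \<Rightarrow> 'm) set"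
  where "cochains n M = {f.
    (\<forall>as. f as \<in> carr M) \<and>
    (\<forall>as. length as \<noteq> n \<longrightarrow> f as = 0) \<and>
    (\<forall>as bs. length as + length bs + 1 = n \<longrightarrow> clinear (\<lambda>x. f (as @ x # bs)))}"

definition coboundary ::
  "nat \<Rightarrow> ('a::complex_algebra, 'm::complex_vector) bimod \<Rightarrow> ('a list \<Rightarrow> 'm) \<Rightarrow> 'a list \<Rightarrow> 'm"
  where "coboundary n M f as =
    (if length as = n + 1 then
       lact M (hd as) (f (tl as))
       + (\<Sum>i<n. (-1) ^ (i + 1) *\<^sub>C f (take i as @ (as ! i * as ! (i + 1)) # drop (i + 2) as))
       + (-1) ^ (n + 1) *\<^sub>C ract M (f (butlast as)) (last as)
     else 0)"

definition hochschild_cocycles ::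
  "nat \<Rightarrow> ('a::complex_algebra, 'm::complex_vector) bimod \<Rightarrow> ('a list \<Rightarrow> 'm) set"
  where "hochschild_cocycles n M = {f \<in> cochains n M. coboundary n M f = 0}"

definition hochschild_coboundaries ::
  "nat \<Rightarrow> ('a::complex_algebra, 'm::complex_vector) bimod \<Rightarrow> ('a list \<Rightarrow> 'm) set"
  where "hochschild_coboundaries n M =
    (case n of 0 \<Rightarrow> {0} | Suc k \<Rightarrow> coboundary k M ` cochains k M)"

definition hochschild_cohomology ::
  "nat \<Rightarrow> ('a::complex_algebra, 'm::complex_vector) bimod \<Rightarrow> ('a list \<Rightarrow> 'm) set vspace"
  where "hochschild_cohomology n M =
    quotient_space (hochschild_cocycles n M) (hochschild_coboundaries n M)"

text \<open>The map \<open>H\<^sup>n(A, M) \<rightarrow> H\<^sup>n(A, N)\<close> induced by a bimodule homomorphism \<open>f : M \<rightarrow> N\<close>.\<close>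

definition hochschild_map ::
  "nat \<Rightarrow> ('a::complex_algebra, 'n::complex_vector) bimod \<Rightarrow> ('m \<Rightarrow> 'n)
    \<Rightarrow> ('a list \<Rightarrow> 'm) set \<Rightarrow> ('a list \<Rightarrow> 'n) set"
  where "hochschild_map n N f X = (\<lambda>\<phi>. f \<circ> \<phi>) ` X + hochschild_coboundaries n N"

end

theory Submission
  imports Defs
begin

text \<open>
  Write \<open>C = A * B\<close>. The isomorphism is induced by restricting a cochain on \<open>C\<close> to arguments from \<open>A\<close>
  and to arguments from \<open>B\<close>. It is visibly linear and natural in the bimodule, so the point is that
  it is bijective in degrees \<open>n \<ge> 2\<close>. This is shown by dimension shifting, for all coefficients at
  once (\<open>restriction_iso_free_product\<close>).

  A \<open>C\<close>-bimodule \<open>M\<close> embeds, by \<open>m \<mapsto> (y \<mapsto> y m)\<close>, into the coinduced bimodule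
  \<open>J = Hom\<^sub>\<complex>(C, M)\<close> with \<open>(c f)(y) = f(y c)\<close> and \<open>(f c)(y) = f(y) c\<close>. Let \<open>Q = J/M\<close>. The higher cohomology of
  \<open>C\<close> with coefficients in \<open>J\<close> vanishes. The same holds for the cohomology of \<open>A\<close> and of \<open>B\<close> with
  coefficients in the restrictions of \<open>J\<close>, because \<open>C\<close> is projective as a right module over \<open>A\<close>
  and over \<open>B\<close> (\<open>coinduced_acyclic\<close>). So for each of the three algebras the connecting map identifies
  \<open>H\<^sup>n\<close> with coefficients in \<open>Q\<close> with \<open>H\<^sup>n\<^sup>+\<^sup>1\<close> with coefficients in \<open>M\<close>, for \<open>n \<ge> 1\<close>
  (\<open>connecting_surjective\<close>, \<open>connecting_injective\<close>). Since connecting maps commute with restriction, the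
  claim for \<open>n\<close> and \<open>Q\<close> implies the claim for \<open>n + 1\<close> and \<open>M\<close> (\<open>restriction_iso_Suc\<close>).

  The induction starts with \<open>H\<^sup>1\<close> and coefficients in \<open>Q\<close> (\<open>restriction_iso_quotient_1\<close>). By the
  universal property of the free product, a derivation on \<open>C\<close> is the same as a pair of derivations on
  \<open>A\<close> and \<open>B\<close>; this gives surjectivity. If a derivation of \<open>C\<close> into \<open>Q\<close> restricts to inner
  derivations, given by \<open>q\<close> on \<open>A\<close> and by \<open>r\<close> on \<open>B\<close>, then lift \<open>q\<close> and \<open>r\<close> to \<open>J\<close> and glue the two
  inner derivations into a derivation of \<open>C\<close> into \<open>J\<close>. It is inner as \<open>J\<close> is acyclic, and hence so is its
  image in \<open>Q\<close>, which is the given derivation. Coefficients in a quotient of a coinduced bimodule are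
  essential here: for arbitrary coefficients the restriction map in degree \<open>1\<close> need not be injective.

  Projectivity is where the Hopf structure enters, through the counits. Right \<open>C\<close>-modules are vector
  spaces with right actions of \<open>A\<close> and of \<open>B\<close> that are unrelated to each other. On \<open>C \<otimes> A\<close> let \<open>A\<close> act
  by multiplication on the right factor, and let \<open>B\<close> act through \<open>C\<close> on \<open>C \<otimes> 1\<close> and through its
  counit on the kernel of the multiplication map \<open>\<mu> : C \<otimes> A \<rightarrow> C\<close>, which is a complement. Then \<open>\<mu>\<close> is
  \<open>C\<close>-linear, so \<open>y \<mapsto> (1 \<otimes> 1) y\<close> is a right \<open>A\<close>-linear section of it (\<open>right_splitting_fp_inl\<close>).
  This avoids normal forms for the elements of a free product.
\<close>

section \<open>Linear maps\<close>

lemma sum_apply: "(\<Sum>i\<in>I. f i) x = (\<Sum>i\<in>I. f i x)"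
  by (induction I rule: infinite_finite_induct) (simp_all add: zero_fun_def plus_fun_def)

lemma scaleC_apply [simp]: "(c *\<^sub>C f) x = c *\<^sub>C f x"
  by (simp add: scaleC_fun_def)

lemma scaleC_minus_one [simp]: "(- 1) *\<^sub>C x = - (x :: 'm::complex_vector)"
  by (metis complex_vector.scale_minus_left scaleC_one)

lemma clinear_apply: "clinear f \<Longrightarrow> clinear (\<lambda>x. f x y)"
  by (rule clinearI) (simp_all add: clinear_add clinear_scaleC)

lemma clinear_comp: "clinear f \<Longrightarrow> clinear g \<Longrightarrow> clinear (\<lambda>x. f (g x))"
  by (rule clinearI) (simp_all add: clinear_add clinear_scaleC)

lemma clinear_zero: "clinear f \<Longrightarrow> f 0 = 0"
  by (metis clinear_scaleC complex_vector.scale_zero_left)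

lemma clinear_diff: "clinear f \<Longrightarrow> f (x - y) = f x - f y"
  by (metis add_diff_cancel clinear_add diff_add_cancel)

lemma clinear_const_zero [simp]: "clinear (\<lambda>x. 0)"
  by (rule clinearI) simp_all

lemma clinear_lmult: "clinear (\<lambda>y. x * y :: 'c::complex_algebra)"
  by (rule clinearI) (simp_all add: semiring_class.distrib_left mult_scaleC_right)

lemma clinear_rmult: "clinear (\<lambda>y. y * x :: 'c::complex_algebra)"
  by (rule clinearI) (simp_all add: semiring_class.distrib_right mult_scaleC_left)

lemma clinear_fun_plus: "clinear f \<Longrightarrow> clinear g \<Longrightarrow> clinear (\<lambda>x. f x + g x)"
  by (rule clinearI) (simp_all add: clinear_add[of f] clinear_add[of g] clinear_scaleC[of f]
    clinear_scaleC[of g] scaleC_add_right)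

lemma clinear_fun_diff: "clinear f \<Longrightarrow> clinear g \<Longrightarrow> clinear (\<lambda>x. f x - g x)"
  by (rule clinearI) (simp_all add: clinear_add[of f] clinear_add[of g] clinear_scaleC[of f]
    clinear_scaleC[of g] complex_vector.scale_right_diff_distrib)

lemma clinear_fun_scale: "clinear f \<Longrightarrow> clinear (\<lambda>x. c *\<^sub>C f x)"
  by (rule clinearI) (simp_all add: clinear_add[of f] clinear_scaleC[of f] scaleC_add_right mult.commute)

lemma algebra_homD:
  assumes "algebra_hom h"
  shows "clinear h" "h 1 = 1" "h (x * y) = h x * h y"
  using assms by (auto simp: algebra_hom_def)

lemma algebra_hom_id: "algebra_hom id"
  by (simp add: algebra_hom_def clinearI)

section \<open>Bimodules\<close>

lemma bimodule_carrier:
  assumes "bimodule M"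
  shows "0 \<in> carr M"
    and "m \<in> carr M \<Longrightarrow> m' \<in> carr M \<Longrightarrow> m + m' \<in> carr M"
    and "m \<in> carr M \<Longrightarrow> m' \<in> carr M \<Longrightarrow> m - m' \<in> carr M"
    and "m \<in> carr M \<Longrightarrow> - m \<in> carr M"
    and "m \<in> carr M \<Longrightarrow> c *\<^sub>C m \<in> carr M"
    and "m \<in> carr M \<Longrightarrow> lact M a m \<in> carr M"
    and "m \<in> carr M \<Longrightarrow> ract M m a \<in> carr M"
    and "(\<And>i. i \<in> I \<Longrightarrow> g i \<in> carr M) \<Longrightarrow> sum g I \<in> carr M"
proof -
  have s: "complex_vector.subspace (carr M)" using assms by (simp add: bimodule_def)
  show "0 \<in> carr M" by (rule complex_vector.subspace_0[OF s])
  show "m + m' \<in> carr M" if "m \<in> carr M" "m' \<in> carr M"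
    by (rule complex_vector.subspace_add[OF s that])
  show "m - m' \<in> carr M" if "m \<in> carr M" "m' \<in> carr M"
    by (rule complex_vector.subspace_diff[OF s that])
  show "- m \<in> carr M" if "m \<in> carr M"
    by (rule complex_vector.subspace_neg[OF s that])
  show "c *\<^sub>C m \<in> carr M" if "m \<in> carr M"
    by (rule complex_vector.subspace_scale[OF s that])
  show "sum g I \<in> carr M" if "\<And>i. i \<in> I \<Longrightarrow> g i \<in> carr M"
    by (rule complex_vector.subspace_sum[OF s that])
  show "m \<in> carr M \<Longrightarrow> lact M a m \<in> carr M" and "m \<in> carr M \<Longrightarrow> ract M m a \<in> carr M"
    using assms by (auto simp: bimodule_def)
qed

lemma bimodule_linear:
  assumes "bimodule M" and "m \<in> carr M"
  shows "clinear (\<lambda>a. lact M a m)" and "clinear (ract M m)"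
  using assms by (auto simp: bimodule_def)

lemma bimodule_act:
  assumes "bimodule M" and "m \<in> carr M"
  shows "m' \<in> carr M \<Longrightarrow> lact M a (m + m') = lact M a m + lact M a m'"
    and "m' \<in> carr M \<Longrightarrow> ract M (m + m') a = ract M m a + ract M m' a"
    and "lact M a (c *\<^sub>C m) = c *\<^sub>C lact M a m"
    and "ract M (c *\<^sub>C m) a = c *\<^sub>C ract M m a"
    and "lact M (a + b) m = lact M a m + lact M b m"
    and "ract M m (a + b) = ract M m a + ract M m b"
    and "lact M (c *\<^sub>C a) m = c *\<^sub>C lact M a m"
    and "ract M m (c *\<^sub>C a) = c *\<^sub>C ract M m a"
    and "lact M 1 m = m" and "ract M m 1 = m"
    and "lact M (a * b) m = lact M a (lact M b m)"
    and "ract M m (a * b) = ract M (ract M m a) b"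
    and "ract M (lact M a m) b = lact M a (ract M m b)"
  using assms clinear_add[OF bimodule_linear(1)[OF assms]] clinear_add[OF bimodule_linear(2)[OF assms]]
    clinear_scaleC[OF bimodule_linear(1)[OF assms]] clinear_scaleC[OF bimodule_linear(2)[OF assms]]
  by (simp_all add: bimodule_def)

lemma bimodule_act_zero:
  assumes "bimodule M"
  shows "lact M a 0 = 0" and "ract M 0 a = 0"
  using bimodule_act(3)[OF assms bimodule_carrier(1)[OF assms], of a 0]
    bimodule_act(4)[OF assms bimodule_carrier(1)[OF assms], of 0 a] by simp_all

lemma bimodule_act_diff:
  assumes "bimodule M" and "m \<in> carr M" and "m' \<in> carr M"
  shows "lact M a (m - m') = lact M a m - lact M a m'"
    and "ract M (m - m') a = ract M m a - ract M m' a"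
  using bimodule_act(1,2)[OF assms(1) bimodule_carrier(3)[OF assms], of m' a] assms(3)
  by (simp_all add: eq_diff_eq)

lemmas bimodule_simps = bimodule_carrier bimodule_act bimodule_act_zero bimodule_act_diff

lemma restrict_bimodule_simps [simp]:
  "carr (restrict_bimodule h M) = carr M"
  "lact (restrict_bimodule h M) a = lact M (h a)"
  "ract (restrict_bimodule h M) m a = ract M m (h a)"
  "restrict_bimodule id M = M"
  by (simp_all add: restrict_bimodule_def)

lemma bimoduleI:
  assumes "complex_vector.subspace (carr M)"
    and "\<And>a m. m \<in> carr M \<Longrightarrow> lact M a m \<in> carr M"
    and "\<And>a m. m \<in> carr M \<Longrightarrow> ract M m a \<in> carr M"
    and "\<And>m. m \<in> carr M \<Longrightarrow> clinear (\<lambda>a. lact M a m)"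
    and "\<And>m. m \<in> carr M \<Longrightarrow> clinear (\<lambda>a. ract M m a)"
    and "\<And>a m m'. m \<in> carr M \<Longrightarrow> m' \<in> carr M \<Longrightarrow> lact M a (m + m') = lact M a m + lact M a m'"
    and "\<And>a m m'. m \<in> carr M \<Longrightarrow> m' \<in> carr M \<Longrightarrow> ract M (m + m') a = ract M m a + ract M m' a"
    and "\<And>a c m. m \<in> carr M \<Longrightarrow> lact M a (c *\<^sub>C m) = c *\<^sub>C lact M a m"
    and "\<And>a c m. m \<in> carr M \<Longrightarrow> ract M (c *\<^sub>C m) a = c *\<^sub>C ract M m a"
    and "\<And>m. m \<in> carr M \<Longrightarrow> lact M 1 m = m"
    and "\<And>m. m \<in> carr M \<Longrightarrow> ract M m 1 = m"
    and "\<And>a b m. m \<in> carr M \<Longrightarrow> lact M (a * b) m = lact M a (lact M b m)"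
    and "\<And>a b m. m \<in> carr M \<Longrightarrow> ract M m (a * b) = ract M (ract M m a) b"
    and "\<And>a b m. m \<in> carr M \<Longrightarrow> lact M a (ract M m b) = ract M (lact M a m) b"
  shows "bimodule M"
  unfolding bimodule_def using assms by auto

lemma bimodule_restrict:
  assumes "bimodule M" and "algebra_hom h"
  shows "bimodule (restrict_bimodule h M)"
proof (rule bimoduleI)
  show "complex_vector.subspace (carr (restrict_bimodule h M))"
    using assms(1) by (simp add: bimodule_def)
  show "clinear (\<lambda>a. lact (restrict_bimodule h M) a m)" "clinear (\<lambda>a. ract (restrict_bimodule h M) m a)"
    if "m \<in> carr (restrict_bimodule h M)" for m
    using that clinear_comp[OF bimodule_linear(1)[OF assms(1)] algebra_homD(1)[OF assms(2)]]
      clinear_comp[OF bimodule_linear(2)[OF assms(1)] algebra_homD(1)[OF assms(2)]]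
    by simp_all
qed (simp_all add: bimodule_simps[OF assms(1)] algebra_homD(2,3)[OF assms(2)])

lemma bimodule_homD:
  assumes "bimodule_hom M N f"
  shows "m \<in> carr M \<Longrightarrow> f m \<in> carr N"
    and "m \<in> carr M \<Longrightarrow> m' \<in> carr M \<Longrightarrow> f (m + m') = f m + f m'"
    and "m \<in> carr M \<Longrightarrow> f (c *\<^sub>C m) = c *\<^sub>C f m"
    and "m \<in> carr M \<Longrightarrow> f (lact M a m) = lact N a (f m)"
    and "m \<in> carr M \<Longrightarrow> f (ract M m a) = ract N (f m) a"
  using assms by (auto simp: bimodule_hom_def)

lemma bimodule_hom_zero: "bimodule M \<Longrightarrow> bimodule_hom M N f \<Longrightarrow> f 0 = 0"
  using bimodule_homD(3)[of M N f 0 0] by (simp add: bimodule_carrier)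

lemma bimodule_hom_diff:
  assumes "bimodule M" and "bimodule_hom M N f" and "m \<in> carr M" and "m' \<in> carr M"
  shows "f (m - m') = f m - f m'"
  using bimodule_homD(2)[OF assms(2) bimodule_carrier(3)[OF assms(1), of m m'] assms(4)] assms(3,4)
  by (simp add: eq_diff_eq)

lemma bimodule_hom_minus:
  "bimodule M \<Longrightarrow> bimodule_hom M N f \<Longrightarrow> m \<in> carr M \<Longrightarrow> f (- m) = - f m"
  using bimodule_hom_diff[of M N f 0 m] by (simp add: bimodule_carrier bimodule_hom_zero)

lemma bimodule_hom_sum:
  assumes "bimodule M" and "bimodule_hom M N f" and "\<And>i. i \<in> I \<Longrightarrow> g i \<in> carr M"
  shows "f (sum g I) = (\<Sum>i\<in>I. f (g i))"
  using assms(3)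
  by (induction I rule: infinite_finite_induct)
    (simp_all add: bimodule_hom_zero[OF assms(1,2)] bimodule_homD(2)[OF assms(2)] bimodule_carrier[OF assms(1)])

lemma bimodule_hom_restrict:
  "bimodule_hom M N f \<Longrightarrow> bimodule_hom (restrict_bimodule h M) (restrict_bimodule h N) f"
  by (simp add: bimodule_hom_def)

section \<open>Cochains\<close>

lemma cochainsD:
  assumes "f \<in> cochains n M"
  shows "f as \<in> carr M" and "length as \<noteq> n \<Longrightarrow> f as = 0"
    and "length as + length bs + 1 = n \<Longrightarrow> clinear (\<lambda>x. f (as @ x # bs))"
  using assms by (auto simp: cochains_def)

lemma cochains_slot: "f \<in> cochains n M \<Longrightarrow> clinear (\<lambda>x. f (as @ x # bs))"
  by (cases "length as + length bs + 1 = n") (simp_all add: cochainsD)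

lemma cochainsI:
  assumes "\<And>as. f as \<in> carr M" and "\<And>as. length as \<noteq> n \<Longrightarrow> f as = 0"
    and "\<And>as bs. clinear (\<lambda>x. f (as @ x # bs))"
  shows "f \<in> cochains n M"
  using assms by (auto simp: cochains_def)

text \<open>
  The Hochschild differential without its leading term \<open>x f(\<dots>)\<close>. These remaining terms do not involve
  the left action. Separating them makes it possible to split off the first argument of a cochain, and
  to compare coefficient bimodules that differ in the left action only.
\<close>

definition bar_tail ::
  "nat \<Rightarrow> ('a::complex_algebra, 'm::complex_vector) bimod \<Rightarrow> ('a list \<Rightarrow> 'm) \<Rightarrow> 'a list \<Rightarrow> 'm"
  where "bar_tail n M f as =
    (\<Sum>i<n. (-1) ^ (i + 1) *\<^sub>C f (take i as @ (as ! i * as ! (i + 1)) # drop (i + 2) as))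
    + (-1) ^ (n + 1) *\<^sub>C ract M (f (butlast as)) (last as)"

lemma coboundary_bar_tail:
  "length as = n + 1 \<Longrightarrow> coboundary n M f as = lact M (hd as) (f (tl as)) + bar_tail n M f as"
  by (simp add: coboundary_def bar_tail_def)

lemma coboundary_wrong_length: "length as \<noteq> n + 1 \<Longrightarrow> coboundary n M f as = 0"
  by (simp add: coboundary_def)

lemma bar_tail_Cons:
  assumes "length as = n + 1"
  shows "bar_tail (Suc n) M f (x # as) =
    - f ((x * hd as) # tl as) - bar_tail n M (\<lambda>ys. f (x # ys)) as"
proof -
  have "as \<noteq> []" using assms by auto
  then have "as ! 0 = hd as" "drop (Suc 0) as = tl as"
    by (simp_all add: hd_conv_nth drop_Suc)
  with \<open>as \<noteq> []\<close> show ?thesis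
    by (simp add: bar_tail_def sum.lessThan_Suc_shift sum_negf del: sum.lessThan_Suc)
qed

lemma bar_tail_in_carrier:
  assumes "bimodule M" and "\<And>ys. f ys \<in> carr M"
  shows "bar_tail n M f as \<in> carr M"
  unfolding bar_tail_def using assms by (intro bimodule_carrier) auto

lemma bar_tail_hom:
  assumes "bimodule M" and "bimodule_hom M N \<phi>" and "\<And>ys. f ys \<in> carr M"
  shows "\<phi> (bar_tail n M f as) = bar_tail n N (\<lambda>ys. \<phi> (f ys)) as"
  unfolding bar_tail_def
  using assms
  by (simp add: bimodule_homD[OF assms(2)] bimodule_hom_sum[OF assms(1,2)] bimodule_carrier[OF assms(1)]
      bimodule_hom_diff[OF assms(1,2)] bimodule_hom_minus[OF assms(1,2)])

lemma bar_tail_add: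
  assumes "bimodule M" and "\<And>ys. f ys \<in> carr M" and "\<And>ys. g ys \<in> carr M"
  shows "bar_tail n M (\<lambda>ys. f ys + g ys) as = bar_tail n M f as + bar_tail n M g as"
  unfolding bar_tail_def
  using assms by (simp add: bimodule_simps scaleC_add_right sum.distrib sum_negf sum_subtractf)

lemma bar_tail_scale:
  assumes "bimodule M" and "\<And>ys. f ys \<in> carr M"
  shows "bar_tail n M (\<lambda>ys. c *\<^sub>C f ys) as = c *\<^sub>C bar_tail n M f as"
  unfolding bar_tail_def
  using assms
  by (simp add: bimodule_simps complex_vector.scale_right_diff_distrib complex_vector.scale_sum_right
      sum_negf mult.commute)

lemma coboundary_hom:
  assumes "bimodule M" and "bimodule_hom M N \<phi>" and "\<And>ys. f ys \<in> carr M"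
  shows "coboundary n N (\<phi> \<circ> f) = \<phi> \<circ> coboundary n M f"
proof
  fix as
  show "coboundary n N (\<phi> \<circ> f) as = (\<phi> \<circ> coboundary n M f) as"
  proof (cases "length as = n + 1")
    case True
    then show ?thesis
      using assms
      by (simp add: coboundary_bar_tail bimodule_homD[OF assms(2)] bar_tail_hom[OF assms(1,2)]
          bimodule_carrier bar_tail_in_carrier o_def)
  next
    case False
    then show ?thesis by (simp add: coboundary_wrong_length bimodule_hom_zero[OF assms(1,2)])
  qed
qed

lemma coboundary_add:
  assumes "bimodule M" and "\<And>ys. f ys \<in> carr M" and "\<And>ys. g ys \<in> carr M"
  shows "coboundary n M (f + g) = coboundary n M f + coboundary n M g"
proof
  fix as
  show "coboundary n M (f + g) as = (coboundary n M f + coboundary n M g) as"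
    using assms
    by (cases "length as = n + 1")
      (simp_all add: coboundary_bar_tail coboundary_wrong_length bar_tail_add bimodule_simps plus_fun_def)
qed

lemma coboundary_scale:
  assumes "bimodule M" and "\<And>ys. f ys \<in> carr M"
  shows "coboundary n M (c *\<^sub>C f) = c *\<^sub>C coboundary n M f"
proof
  fix as
  show "coboundary n M (c *\<^sub>C f) as = (c *\<^sub>C coboundary n M f) as"
    using assms
    by (cases "length as = n + 1")
      (simp_all add: coboundary_bar_tail coboundary_wrong_length bar_tail_scale bimodule_simps
         scaleC_fun_def scaleC_add_right)
qed

lemma subspace_cochains:
  assumes "bimodule M"
  shows "complex_vector.subspace (cochains n M)"
  unfolding complex_vector.subspace_def
proof (intro conjI ballI allI)
  show "0 \<in> cochains n M" by (rule cochainsI) (simp_all add: bimodule_carrier[OF assms])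
  show "f + g \<in> cochains n M" if "f \<in> cochains n M" "g \<in> cochains n M" for f g
    using that
    by (intro cochainsI) (simp_all add: cochainsD bimodule_carrier[OF assms] clinear_fun_plus cochains_slot)
  show "c *\<^sub>C f \<in> cochains n M" if "f \<in> cochains n M" for c f
    using that
    by (intro cochainsI) (simp_all add: cochainsD bimodule_carrier[OF assms] clinear_fun_scale cochains_slot)
qed

lemma subspace_cocycles:
  assumes "bimodule M"
  shows "complex_vector.subspace (hochschild_cocycles n M)"
  unfolding complex_vector.subspace_def hochschild_cocycles_def
  using subspace_cochains[OF assms, of n] coboundary_scale[OF assms, of 0 n 0] bimodule_carrier(1)[OF assms]
  by (auto simp: complex_vector.subspace_def coboundary_add[OF assms] coboundary_scale[OF assms] cochainsD)

lemma subspace_coboundaries: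
  assumes "bimodule M"
  shows "complex_vector.subspace (hochschild_coboundaries n M)"
proof (cases n)
  case 0
  then show ?thesis by (simp add: hochschild_coboundaries_def complex_vector.subspace_single_0)
next
  case (Suc k)
  have "hochschild_coboundaries n M = coboundary k M ` cochains k M"
    by (simp add: Suc hochschild_coboundaries_def)
  moreover note s = subspace_cochains[OF assms, of k]
  moreover have "coboundary k M 0 = 0"
    using coboundary_scale[OF assms, of 0 k 0] bimodule_carrier(1)[OF assms] by simp
  moreover have "coboundary k M f + coboundary k M g = coboundary k M (f + g)"
    "c *\<^sub>C coboundary k M f = coboundary k M (c *\<^sub>C f)"
    if "f \<in> cochains k M" "g \<in> cochains k M" for f g c
    using that by (simp_all add: coboundary_add[OF assms] coboundary_scale[OF assms] cochainsD)
  ultimately show ?thesis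
    unfolding complex_vector.subspace_def by (smt (verit) imageE imageI)
qed

subsection \<open>Change of coefficients and restriction\<close>

lemma cochains_hom:
  assumes "bimodule M" and "bimodule_hom M N \<phi>" and "f \<in> cochains n M"
  shows "\<phi> \<circ> f \<in> cochains n N"
proof (rule cochainsI)
  show "clinear (\<lambda>x. (\<phi> \<circ> f) (as @ x # bs))" for as bs
    using clinear_add[OF cochains_slot[OF assms(3), of as bs]]
      clinear_scaleC[OF cochains_slot[OF assms(3), of as bs]] assms(3)
    by (intro clinearI) (simp_all add: bimodule_homD[OF assms(2)] cochainsD)
qed (use assms in \<open>auto simp: cochainsD bimodule_homD[OF assms(2)] bimodule_hom_zero[OF assms(1,2)]\<close>)

lemma cocycles_hom:
  assumes "bimodule M" and "bimodule_hom M N \<phi>" and "f \<in> hochschild_cocycles n M"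
  shows "\<phi> \<circ> f \<in> hochschild_cocycles n N"
  using assms(3) cochains_hom[OF assms(1,2)] bimodule_hom_zero[OF assms(1,2)]
  by (auto simp: hochschild_cocycles_def coboundary_hom[OF assms(1,2)] cochainsD)

lemma coboundaries_hom:
  assumes "bimodule M" and "bimodule_hom M N \<phi>" and "f \<in> hochschild_coboundaries n M"
  shows "\<phi> \<circ> f \<in> hochschild_coboundaries n N"
proof (cases n)
  case 0
  then show ?thesis using assms(3) bimodule_hom_zero[OF assms(1,2)]
    by (auto simp: hochschild_coboundaries_def)
next
  case (Suc k)
  then obtain g where "g \<in> cochains k M" "f = coboundary k M g"
    using assms(3) by (auto simp: hochschild_coboundaries_def)
  then have "\<phi> \<circ> f = coboundary k N (\<phi> \<circ> g)" "\<phi> \<circ> g \<in> cochains k N"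
    using cochains_hom[OF assms(1,2)] by (simp_all add: coboundary_hom[OF assms(1,2)] cochainsD)
  then show ?thesis by (simp add: Suc hochschild_coboundaries_def)
qed

lemma cochains_restrict:
  assumes "algebra_hom h" and "f \<in> cochains n M"
  shows "f \<circ> map h \<in> cochains n (restrict_bimodule h M)"
proof (rule cochainsI)
  show "clinear (\<lambda>x. (f \<circ> map h) (as @ x # bs))" for as bs
    using clinear_comp[OF cochains_slot[OF assms(2)] algebra_homD(1)[OF assms(1)]] by simp
qed (use assms in \<open>auto simp: cochainsD\<close>)

lemma coboundary_restrict:
  assumes "algebra_hom h"
  shows "coboundary n (restrict_bimodule h M) (f \<circ> map h) = coboundary n M f \<circ> map h"
proof
  fix as
  show "coboundary n (restrict_bimodule h M) (f \<circ> map h) as = (coboundary n M f \<circ> map h) as"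
  proof (cases "length as = n + 1")
    case True
    then have "as \<noteq> []" by auto
    with True show ?thesis
      by (simp add: coboundary_def hd_map map_tl last_map map_butlast take_map drop_map
          algebra_homD(3)[OF assms])
  qed (simp add: coboundary_wrong_length)
qed

lemma cocycles_restrict:
  assumes "algebra_hom h" and "f \<in> hochschild_cocycles n M"
  shows "f \<circ> map h \<in> hochschild_cocycles n (restrict_bimodule h M)"
  using assms(2) cochains_restrict[OF assms(1)]
  by (auto simp: hochschild_cocycles_def coboundary_restrict[OF assms(1)])

lemma coboundaries_restrict:
  assumes "algebra_hom h" and "f \<in> hochschild_coboundaries n M"
  shows "f \<circ> map h \<in> hochschild_coboundaries n (restrict_bimodule h M)"
  using assms(2) cochains_restrict[OF assms(1)]
  by (cases n) (force simp: hochschild_coboundaries_def coboundary_restrict[OF assms(1), symmetric])+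

section \<open>Coinduced bimodules and the dimension shift\<close>

definition coinduced ::
  "('c::complex_algebra, 'm::complex_vector) bimod \<Rightarrow> ('c, 'c \<Rightarrow> 'm) bimod"
  where "coinduced M =
    \<lparr>carr = {f. clinear f \<and> range f \<subseteq> carr M},
     lact = (\<lambda>c f y. f (y * c)),
     ract = (\<lambda>f c y. ract M (f y) c)\<rparr>"

text \<open>
  The quotient \<open>J/M\<close> of the coinduced bimodule, modelled on the complement
  \<open>{f. f 1 = 0}\<close> of the image of \<open>M\<close>. A function in \<open>J\<close> is projected to it by subtracting
  \<open>y \<mapsto> y f(1)\<close>, and applying this projection to \<open>c f\<close> yields the left action used here.
\<close>

definition coinduced_quotient ::
  "('c::complex_algebra, 'm::complex_vector) bimod \<Rightarrow> ('c, 'c \<Rightarrow> 'm) bimod"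
  where "coinduced_quotient M =
    \<lparr>carr = {f. clinear f \<and> range f \<subseteq> carr M \<and> f 1 = 0},
     lact = (\<lambda>c f y. f (y * c) - lact M y (f c)),
     ract = (\<lambda>f c y. ract M (f y) c)\<rparr>"

definition to_quotient ::
  "('c::complex_algebra, 'm::complex_vector) bimod \<Rightarrow> ('c \<Rightarrow> 'm) \<Rightarrow> 'c \<Rightarrow> 'm"
  where "to_quotient M f y = f y - lact M y (f 1)"

lemma coinduced_simps [simp]:
  "f \<in> carr (coinduced M) \<longleftrightarrow> clinear f \<and> (\<forall>y. f y \<in> carr M)"
  "lact (coinduced M) c f = (\<lambda>y. f (y * c))"
  "ract (coinduced M) f c = (\<lambda>y. ract M (f y) c)"
  by (auto simp: coinduced_def)

lemma coinduced_quotient_simps [simp]: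
  "f \<in> carr (coinduced_quotient M) \<longleftrightarrow> clinear f \<and> (\<forall>y. f y \<in> carr M) \<and> f 1 = 0"
  "lact (coinduced_quotient M) c f = (\<lambda>y. f (y * c) - lact M y (f c))"
  "ract (coinduced_quotient M) f c = (\<lambda>y. ract M (f y) c)"
  by (auto simp: coinduced_quotient_def)

lemma clinear_ract:
  assumes "bimodule M" and "clinear f" and "\<And>y. f y \<in> carr M"
  shows "clinear (\<lambda>y. ract M (f y) c)"
  by (rule clinearI)
    (simp_all add: clinear_add[OF assms(2)] clinear_scaleC[OF assms(2)] assms(3) bimodule_act[OF assms(1)])

lemma clinear_mult_right: "clinear f \<Longrightarrow> clinear (\<lambda>y. f (y * c))"
  for c :: "'c::complex_algebra"
  by (rule clinear_comp[OF _ clinear_rmult])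

lemma clinear_mult_left: "clinear f \<Longrightarrow> clinear (\<lambda>y. f (c * y))"
  for c :: "'c::complex_algebra"
  by (rule clinear_comp[OF _ clinear_lmult])

lemma clinear_pointwise: "(\<And>y. clinear (\<lambda>a. f a y)) \<Longrightarrow> clinear f"
  by (rule clinearI) (auto simp: fun_eq_iff plus_fun_def Vector_Spaces.linear_iff)

lemma subspace_pointwise:
  assumes "bimodule M"
  shows "complex_vector.subspace {f. clinear f \<and> (\<forall>y. f y \<in> carr M)}"
    and "complex_vector.subspace {f. clinear f \<and> (\<forall>y. f y \<in> carr M) \<and> f z = 0}"
  unfolding complex_vector.subspace_def
  by (auto simp: bimodule_carrier[OF assms] zero_fun_def plus_fun_def scaleC_fun_def
      intro!: clinear_fun_plus clinear_fun_scale)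

lemma bimodule_coinduced:
  assumes "bimodule M"
  shows "bimodule (coinduced M)"
proof (rule bimoduleI)
  have "carr (coinduced M) = {f. clinear f \<and> (\<forall>y. f y \<in> carr M)}"
    by auto
  then show "complex_vector.subspace (carr (coinduced M))"
    by (simp only: subspace_pointwise(1)[OF assms])
  fix f assume f: "f \<in> carr (coinduced M)"
  show "clinear (\<lambda>a. lact (coinduced M) a f)"
    using f by (intro clinear_pointwise) (simp add: clinear_mult_left)
  show "clinear (\<lambda>a. ract (coinduced M) f a)"
    using f bimodule_linear(2)[OF assms] by (intro clinear_pointwise) simp
qed (simp_all add: clinear_mult_right clinear_ract[OF assms] bimodule_simps[OF assms] fun_eq_iff mult.assoc)

lemma bimodule_coinduced_quotient:
  assumes "bimodule M"
  shows "bimodule (coinduced_quotient M)"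
proof (rule bimoduleI)
  have "carr (coinduced_quotient M) = {f. clinear f \<and> (\<forall>y. f y \<in> carr M) \<and> f 1 = 0}"
    by auto
  then show "complex_vector.subspace (carr (coinduced_quotient M))"
    by (simp only: subspace_pointwise(2)[OF assms])
  fix f assume f: "f \<in> carr (coinduced_quotient M)"
  have "clinear (\<lambda>c. f (y * c) - lact M y (f c))" for y
    by (rule clinearI)
      (use f in \<open>simp_all add: clinear_add[of f] clinear_scaleC[of f] bimodule_simps[OF assms]
        semiring_class.distrib_left mult_scaleC_right complex_vector.scale_right_diff_distrib\<close>)
  then show "clinear (\<lambda>a. lact (coinduced_quotient M) a f)"
    using f by (intro clinear_pointwise) simp
  show "clinear (\<lambda>a. ract (coinduced_quotient M) f a)"
    using f bimodule_linear(2)[OF assms] by (intro clinear_pointwise) simp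
  fix a
  have "clinear (\<lambda>y. f (y * a) - lact M y (f a))"
    using f bimodule_linear(1)[OF assms] by (intro clinear_fun_diff clinear_mult_right) simp_all
  then show "lact (coinduced_quotient M) a f \<in> carr (coinduced_quotient M)"
    using f by (simp add: bimodule_simps[OF assms])
qed (simp_all add: clinear_mult_right clinear_ract[OF assms] bimodule_simps[OF assms] fun_eq_iff mult.assoc
      complex_vector.scale_right_diff_distrib)

lemma to_quotient_hom:
  assumes "bimodule M"
  shows "bimodule_hom (coinduced M) (coinduced_quotient M) (to_quotient M)"
  unfolding bimodule_hom_def
proof (intro conjI ballI allI)
  fix f assume f: "f \<in> carr (coinduced M)"
  have "clinear (to_quotient M f)"
    unfolding to_quotient_def using f bimodule_linear(1)[OF assms]
    by (intro clinear_fun_diff) simp_all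
  then show "to_quotient M f \<in> carr (coinduced_quotient M)"
    using f by (simp add: to_quotient_def bimodule_simps[OF assms])
qed (auto simp: to_quotient_def fun_eq_iff bimodule_simps[OF assms] complex_vector.scale_right_diff_distrib)

text \<open>
  The embedding of \<open>M\<close> into the coinduced bimodule; \<open>to_quotient M\<close> is the cokernel map, and together
  they form the short exact sequence behind the dimension shift.
\<close>

lemma coinduced_unit_hom:
  assumes "bimodule M"
  shows "bimodule_hom M (coinduced M) (\<lambda>m y. lact M y m)"
  unfolding bimodule_hom_def
  by (auto simp: fun_eq_iff bimodule_simps[OF assms] bimodule_linear[OF assms])

lemma bar_tail_apply:
  "bar_tail n (restrict_bimodule h (coinduced M)) f as y = bar_tail n (restrict_bimodule h M) (\<lambda>ys. f ys y) as"
  "bar_tail n (restrict_bimodule h (coinduced_quotient M)) f as y = bar_tail n (restrict_bimodule h M) (\<lambda>ys. f ys y) as"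
  by (simp_all add: bar_tail_def sum_apply plus_fun_def)

text \<open>
  The connecting map of that sequence on cochains: the differential of \<open>f\<close>, regarded as a
  \<open>J\<close>-valued cochain, takes values in the image of \<open>M\<close> as soon as \<open>f\<close> is a cocycle for the quotient.
  Evaluation at \<open>1\<close> recovers the element of \<open>M\<close>, and all terms but the leading one vanish there. So
  the first argument of the new cochain is simply fed into the function that \<open>f\<close> takes as its value.
\<close>

definition connecting :: "('a \<Rightarrow> 'c) \<Rightarrow> ('a list \<Rightarrow> 'c \<Rightarrow> 'm::zero) \<Rightarrow> 'a list \<Rightarrow> 'm"
  where "connecting h f as = (case as of [] \<Rightarrow> 0 | x # xs \<Rightarrow> f xs (h x))"

lemma connecting_simps [simp]:
  "connecting h f [] = 0" "connecting h f (x # xs) = f xs (h x)"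
  by (simp_all add: connecting_def)

lemma connecting_cochain:
  assumes "bimodule M" and "algebra_hom h" and "f \<in> cochains n (restrict_bimodule h (coinduced_quotient M))"
  shows "connecting h f \<in> cochains (Suc n) (restrict_bimodule h M)"
proof (rule cochainsI)
  note fD = cochainsD(1)[OF assms(3), simplified]
  show "connecting h f as \<in> carr (restrict_bimodule h M)" for as
    using fD by (cases as) (simp_all add: bimodule_carrier[OF assms(1)])
  show "connecting h f as = 0" if "length as \<noteq> Suc n" for as
    using that cochainsD(2)[OF assms(3)] by (cases as) auto
  show "clinear (\<lambda>x. connecting h f (as @ x # bs))" for as bs
  proof (cases as)
    case Nil
    then show ?thesis
      using clinear_comp[of "f bs" h] fD algebra_homD(1)[OF assms(2)] by simp
  next
    case (Cons a as')
    then show ?thesis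
      using clinear_apply[OF cochains_slot[OF assms(3), of as' bs], of "h a"] by simp
  qed
qed

text \<open>
  The leading term of the left-hand side and the first term of its tail are the two parts of the twisted
  left action on the quotient, up to sign, and the remaining terms on the two sides agree one by one.
\<close>

lemma coboundary_connecting:
  assumes "bimodule M" and "algebra_hom h" and "\<And>ys. f ys \<in> carr (coinduced_quotient M)"
  shows "coboundary (Suc n) (restrict_bimodule h M) (connecting h f) =
    - connecting h (coboundary n (restrict_bimodule h (coinduced_quotient M)) f)"
proof
  fix as
  show "coboundary (Suc n) (restrict_bimodule h M) (connecting h f) as =
    (- connecting h (coboundary n (restrict_bimodule h (coinduced_quotient M)) f)) as"
  proof (cases "length as = Suc (Suc n)")
    case True
    then obtain x y bs where as: "as = x # y # bs" and l: "length (y # bs) = n + 1"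
      by (metis Suc_eq_plus1 length_Suc_conv)
    show ?thesis
      using l True
      by (simp add: as coboundary_bar_tail bar_tail_Cons bar_tail_apply algebra_homD(3)[OF assms(2)] plus_fun_def)
  next
    case False
    then show ?thesis
      by (cases as) (simp_all add: coboundary_wrong_length)
  qed
qed

lemma coboundary_coinduced_quotient:
  assumes "bimodule M" and "f \<in> cochains n (restrict_bimodule h (coinduced_quotient M))"
  shows "coboundary n (restrict_bimodule h (coinduced M)) f =
    coboundary n (restrict_bimodule h (coinduced_quotient M)) f + ((\<lambda>m y. lact M y m) \<circ> connecting h f)"
proof
  fix as
  show "coboundary n (restrict_bimodule h (coinduced M)) f as =
    (coboundary n (restrict_bimodule h (coinduced_quotient M)) f + ((\<lambda>m y. lact M y m) \<circ> connecting h f)) as"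
  proof (cases "length as = n + 1")
    case True
    then obtain x xs where "as = x # xs" by (cases as) auto
    with True show ?thesis
      by (simp add: coboundary_bar_tail fun_eq_iff bar_tail_apply plus_fun_def)
  next
    case False
    then have "connecting h f as = 0"
      using cochainsD(2)[OF assms(2)] by (cases as) auto
    with False show ?thesis
      by (simp add: coboundary_wrong_length bimodule_act_zero[OF assms(1)] zero_fun_def plus_fun_def)
  qed
qed

section \<open>Splittings and acyclicity\<close>

subsection \<open>Bilinear maps on tensor products\<close>

lemma tensor_lift_linear: "bilinear_map \<beta> \<Longrightarrow> clinear (tensor_lift \<beta>)"
  by (rule clinearI) (simp_all add: tensor_lift_simps)

lemma bilinear_mapD:
  assumes "bilinear_map \<beta>"
  shows "\<beta> (a + a') b = \<beta> a b + \<beta> a' b" and "\<beta> (c *\<^sub>C a) b = c *\<^sub>C \<beta> a b"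
    and "\<beta> a (b + b') = \<beta> a b + \<beta> a b'" and "\<beta> a (c *\<^sub>C b) = c *\<^sub>C \<beta> a b"
  using assms by (auto simp: bilinear_map_def Vector_Spaces.linear_iff)

lemma tensor_pure_mult:
  "(a \<otimes> b) * (c \<otimes> d) = (a * c) \<otimes> (b * d)" for a c :: "'a::complex_algebra" and b d :: "'b::complex_algebra"
proof -
  have bil: "bilinear_map (\<lambda>c d. (a * c) \<otimes> (b * d))" for a :: 'a and b :: 'b
    by (rule bilinear_mapI)
      (simp_all add: semiring_class.distrib_left mult_scaleC_right tensor_pure_add_left tensor_pure_add_right
        tensor_pure_scaleC_left tensor_pure_scaleC_right)
  have "bilinear_map (\<lambda>a b. tensor_lift (\<lambda>c d. (a * c) \<otimes> (b * d)) (c \<otimes> d))"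
    unfolding tensor_lift_pure[OF bil]
    by (rule bilinear_mapI)
      (simp_all add: semiring_class.distrib_right mult_scaleC_left tensor_pure_add_left tensor_pure_add_right
        tensor_pure_scaleC_left tensor_pure_scaleC_right)
  then show ?thesis
    unfolding times_tensor_def by (simp add: tensor_lift_pure bil)
qed

lemma tensor_lift_clinear:
  assumes "bilinear_map \<beta>" and "clinear g"
  shows "tensor_lift (\<lambda>a b. g (\<beta> a b)) t = g (tensor_lift \<beta> t)"
proof -
  have "bilinear_map (\<lambda>a b. g (\<beta> a b))"
    by (rule bilinear_mapI)
      (simp_all add: bilinear_mapD[OF assms(1)] clinear_add[OF assms(2)] clinear_scaleC[OF assms(2)])
  then show ?thesis
    by (induction t rule: tensor_induct)
      (simp_all add: tensor_lift_simps assms(1) clinear_add[OF assms(2)] clinear_scaleC[OF assms(2)])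
qed

lemma bilinear_map_add:
  assumes "bilinear_map \<beta>" and "bilinear_map \<gamma>"
  shows "bilinear_map (\<lambda>a b. \<beta> a b + \<gamma> a b)"
  by (rule bilinear_mapI)
    (simp_all add: bilinear_mapD[OF assms(1)] bilinear_mapD[OF assms(2)] scaleC_add_right)

lemma bilinear_map_scale:
  assumes "bilinear_map \<beta>"
  shows "bilinear_map (\<lambda>a b. c *\<^sub>C \<beta> a b)"
  by (rule bilinear_mapI) (simp_all add: bilinear_mapD[OF assms] scaleC_add_right mult.commute)

lemma tensor_lift_fun_add:
  assumes "bilinear_map \<beta>" and "bilinear_map \<gamma>"
  shows "tensor_lift (\<lambda>a b. \<beta> a b + \<gamma> a b) t = tensor_lift \<beta> t + tensor_lift \<gamma> t"
  by (induction t rule: tensor_induct)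
    (simp_all add: tensor_lift_simps assms bilinear_map_add scaleC_add_right)

lemma tensor_lift_fun_scale:
  assumes "bilinear_map \<beta>"
  shows "tensor_lift (\<lambda>a b. c *\<^sub>C \<beta> a b) t = c *\<^sub>C tensor_lift \<beta> t"
  by (induction t rule: tensor_induct)
    (simp_all add: tensor_lift_simps assms bilinear_map_scale scaleC_add_right mult.commute)

lemma tensor_lift_fun_zero:
  fixes t :: "('a::complex_vector, 'b::complex_vector) tensor"
  shows "tensor_lift (\<lambda>a b. 0) t = (0 :: 'm::complex_vector)"
proof -
  have "bilinear_map (\<lambda>(a :: 'a) (b :: 'b). 0 :: 'm)" by (rule bilinear_mapI) simp_all
  then show ?thesis by (induction t rule: tensor_induct) (simp_all add: tensor_lift_simps)
qed

lemma tensor_lift_in_carrier: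
  assumes "bimodule M" and "bilinear_map \<beta>" and "\<And>a b. \<beta> a b \<in> carr M"
  shows "tensor_lift \<beta> t \<in> carr M"
  by (induction t rule: tensor_induct) (simp_all add: tensor_lift_simps assms bimodule_carrier[OF assms(1)])

lemma tensor_lift_mult_right:
  fixes \<beta> :: "'a::complex_algebra \<Rightarrow> 'b::complex_algebra \<Rightarrow> 'm::complex_vector"
  assumes "bilinear_map \<beta>"
  shows "tensor_lift \<beta> (t * (1 \<otimes> x)) = tensor_lift (\<lambda>a b. \<beta> a (b * x)) t"
proof -
  have "bilinear_map (\<lambda>a b. \<beta> a (b * x))"
    by (rule bilinear_mapI)
      (simp_all add: bilinear_mapD[OF assms] semiring_class.distrib_right mult_scaleC_left)
  then show ?thesis
    by (induction t rule: tensor_induct)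
      (simp_all add: tensor_lift_simps assms tensor_pure_mult semiring_class.distrib_right mult_scaleC_left)
qed

lemma bilinear_bar_tail:
  assumes "bimodule M" and "\<And>ys. bilinear_map (F ys)" and "\<And>ys a b. F ys a b \<in> carr M"
  shows "bilinear_map (\<lambda>a b. bar_tail n M (\<lambda>ys. F ys a b) as)"
  by (rule bilinear_mapI)
    (simp_all add: bilinear_mapD[OF assms(2)] bar_tail_add[OF assms(1)] bar_tail_scale[OF assms(1)] assms(3))

text \<open>
  Writing \<open>t\<close> as a sum of pure tensors turns both sides into the same finite sum, since
  the terms involved are linear in the cochain.
\<close>

lemma bar_tail_tensor_lift:
  assumes "bimodule M" and "\<And>ys. bilinear_map (F ys)" and "\<And>ys a b. F ys a b \<in> carr M"
  shows "bar_tail n M (\<lambda>ys. tensor_lift (F ys) t) as =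
    tensor_lift (\<lambda>a b. bar_tail n M (\<lambda>ys. F ys a b) as) t"
  by (induction t rule: tensor_induct)
    (simp_all add: tensor_lift_simps assms(2) bilinear_bar_tail[OF assms] bar_tail_add[OF assms(1)]
      bar_tail_scale[OF assms(1)] tensor_lift_in_carrier[OF assms(1,2,3)])

subsection \<open>Acyclicity of coinduced bimodules\<close>

text \<open>
  A right \<open>X\<close>-linear section of \<open>C \<otimes> X \<rightarrow> C\<close>, \<open>c \<otimes> x \<mapsto> c h(x)\<close>. It exhibits \<open>C\<close> as a direct summand of a
  free right \<open>X\<close>-module.
\<close>

definition right_splitting ::
  "('x::complex_algebra \<Rightarrow> 'c::complex_algebra) \<Rightarrow> ('c \<Rightarrow> ('c, 'x) tensor) \<Rightarrow> bool"
  where "right_splitting h r \<longleftrightarrow>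
    clinear r \<and> (\<forall>y x. r (y * h x) = r y * (1 \<otimes> x)) \<and> (\<forall>y. tensor_lift (\<lambda>c x. c * h x) (r y) = y)"

lemma bilinear_map_hom_mult:
  assumes "algebra_hom h"
  shows "bilinear_map (\<lambda>c x. c * h x)"
  by (rule bilinear_mapI)
    (simp_all add: clinear_add[OF algebra_homD(1)[OF assms]] clinear_scaleC[OF algebra_homD(1)[OF assms]]
      semiring_class.distrib_left semiring_class.distrib_right mult_scaleC_left mult_scaleC_right)

text \<open>
  With \<open>r(y) = \<Sum> c \<otimes> x\<close>, a primitive of the cocycle \<open>z\<close> is
  \<open>w(x\<^sub>1, \<dots>, x\<^sub>n)(y) = \<Sum> z(x, x\<^sub>1, \<dots>, x\<^sub>n)(c)\<close>. The cocycle identity for \<open>z\<close> at \<open>(x, x\<^sub>1, \<dots>)\<close>,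
  evaluated at \<open>c\<close>, has the leading term \<open>z(x\<^sub>1, \<dots>)(c h(x))\<close>, and \<open>\<Sum> c h(x) = y\<close>. Right linearity of \<open>r\<close>
  moves the left action of \<open>x\<^sub>1\<close> on \<open>w\<close>, that is, the multiplication of \<open>y\<close> by \<open>h(x\<^sub>1)\<close>, into the
  first argument of \<open>z\<close>.
\<close>

lemma coinduced_acyclic:
  assumes M: "bimodule M" and h: "algebra_hom h" and r: "right_splitting h r"
    and z: "z \<in> hochschild_cocycles (Suc n) (restrict_bimodule h (coinduced M))"
  obtains w where "w \<in> cochains n (restrict_bimodule h (coinduced M))"
    and "coboundary n (restrict_bimodule h (coinduced M)) w = z"
proof
  let ?J = "restrict_bimodule h (coinduced M)" and ?M = "restrict_bimodule h M"
  have M': "bimodule ?M" by (rule bimodule_restrict[OF M h])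
  have zc: "z \<in> cochains (Suc n) ?J" and zd: "coboundary (Suc n) ?J z = 0"
    using z by (auto simp: hochschild_cocycles_def)
  have rl: "clinear r" and rm: "r (y * h x) = r y * (1 \<otimes> x)"
    and ru: "tensor_lift (\<lambda>c x. c * h x) (r y) = y" for x y
    using r by (auto simp: right_splitting_def)
  define F where "F ys c x = z (x # ys) c" for ys c x
  have z_carr: "clinear (z ys)" "z ys c \<in> carr M" for ys c
    using cochainsD(1)[OF zc] by simp_all
  have F: "bilinear_map (F ys)" for ys
    unfolding F_def bilinear_map_def
    using z_carr clinear_apply[OF cochains_slot[OF zc, of "[]" ys]] by simp
  have F_carr: "F ys c x \<in> carr ?M" for ys c x by (simp add: F_def z_carr)
  define w where "w ys y = tensor_lift (F ys) (r y)" for ys y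
  show "w \<in> cochains n ?J"
  proof (rule cochainsI)
    show "w ys \<in> carr ?J" for ys
      using clinear_comp[OF tensor_lift_linear[OF F] rl] tensor_lift_in_carrier[OF M' F F_carr]
      by (simp add: w_def[abs_def])
    show "w ys = 0" if "length ys \<noteq> n" for ys
    proof -
      have "F ys = (\<lambda>c x. 0)"
        using cochainsD(2)[OF zc] that by (auto simp: F_def[abs_def] fun_eq_iff)
      then show ?thesis by (simp add: w_def[abs_def] tensor_lift_fun_zero zero_fun_def)
    qed
    show "clinear (\<lambda>x. w (as @ x # bs))" for as bs
    proof (rule clinear_pointwise, rule clinearI)
      fix y x x' k
      note slot = cochains_slot[OF zc, of "v # as" bs for v]
      have "F (as @ (x + x') # bs) = (\<lambda>c v. F (as @ x # bs) c v + F (as @ x' # bs) c v)"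
        using clinear_add[OF slot] by (simp add: F_def fun_eq_iff)
      then show "w (as @ (x + x') # bs) y = w (as @ x # bs) y + w (as @ x' # bs) y"
        by (simp add: w_def tensor_lift_fun_add[OF F F])
      have "F (as @ (k *\<^sub>C x) # bs) = (\<lambda>c v. k *\<^sub>C F (as @ x # bs) c v)"
        using clinear_scaleC[OF slot] by (simp add: F_def fun_eq_iff)
      then show "w (as @ (k *\<^sub>C x) # bs) y = k *\<^sub>C w (as @ x # bs) y"
        by (simp add: w_def tensor_lift_fun_scale[OF F])
    qed
  qed
  show "coboundary n ?J w = z"
  proof (rule ext, rule ext)
    fix as y
    show "coboundary n ?J w as y = z as y"
    proof (cases "length as = n + 1")
      case True
      then obtain a bs where as: "as = a # bs" by (cases as) auto
      define T where "T c x = bar_tail n ?M (\<lambda>ys. F ys c x) as" for c x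
      define G where "G c x = F bs c (x * a)" for c x
      have T: "bilinear_map T"
        unfolding T_def by (rule bilinear_bar_tail[OF M' F F_carr])
      have G: "bilinear_map G"
        unfolding G_def by (rule bilinear_mapI)
          (simp_all add: bilinear_mapD[OF F] semiring_class.distrib_right mult_scaleC_left)
      have "z as (c * h x) = G c x + T c x" for c x
      proof -
        have "coboundary (Suc n) ?J z (x # as) c = 0" using zd by simp
        then show ?thesis
          using True by (simp add: coboundary_bar_tail bar_tail_apply bar_tail_Cons plus_fun_def
              G_def T_def F_def as algebra_simps)
      qed
      then have "tensor_lift (\<lambda>c x. z as (c * h x)) (r y) = tensor_lift G (r y) + tensor_lift T (r y)"
        by (simp add: tensor_lift_fun_add[OF G T])
      moreover have "tensor_lift (\<lambda>c x. z as (c * h x)) (r y) = z as y"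
        using tensor_lift_clinear[OF bilinear_map_hom_mult[OF h] z_carr(1)] by (simp add: ru)
      moreover have "w bs (y * h a) = tensor_lift G (r y)"
        by (simp add: w_def rm tensor_lift_mult_right[OF F] G_def[abs_def])
      moreover have "bar_tail n ?M (\<lambda>ys. w ys y) as = tensor_lift T (r y)"
        by (simp add: w_def bar_tail_tensor_lift[OF M' F F_carr] T_def[abs_def])
      ultimately show ?thesis
        using True by (simp add: coboundary_bar_tail bar_tail_apply plus_fun_def as)
    next
      case False
      then show ?thesis using cochainsD(2)[OF zc] by (simp add: coboundary_wrong_length)
    qed
  qed
qed

lemma right_splitting_id:
  "right_splitting (id :: 'c::complex_algebra \<Rightarrow> 'c) (\<lambda>y. 1 \<otimes> y)"
  unfolding right_splitting_def tensor_lift_pure[OF bilinear_map_hom_mult[OF algebra_hom_id]]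
  by (auto intro!: clinearI simp: tensor_pure_add_right tensor_pure_scaleC_right tensor_pure_mult)

subsection \<open>The connecting map on cohomology\<close>

lemma connecting_cocycle:
  assumes "bimodule M" and "algebra_hom h"
    and "f \<in> hochschild_cocycles n (restrict_bimodule h (coinduced_quotient M))"
  shows "connecting h f \<in> hochschild_cocycles (Suc n) (restrict_bimodule h M)"
proof -
  have f: "f \<in> cochains n (restrict_bimodule h (coinduced_quotient M))"
    and d: "coboundary n (restrict_bimodule h (coinduced_quotient M)) f = 0"
    using assms(3) by (auto simp: hochschild_cocycles_def)
  have "connecting h (coboundary n (restrict_bimodule h (coinduced_quotient M)) f) = 0"
    unfolding d by (auto simp: fun_eq_iff connecting_def split: list.split)
  then show ?thesis
    using coboundary_connecting[OF assms(1,2), of f n] cochainsD(1)[OF f]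
      connecting_cochain[OF assms(1,2) f] by (simp add: hochschild_cocycles_def)
qed

lemma connecting_coboundary:
  assumes "bimodule M" and "algebra_hom h"
    and "f \<in> hochschild_coboundaries (Suc n) (restrict_bimodule h (coinduced_quotient M))"
  shows "connecting h f \<in> hochschild_coboundaries (Suc (Suc n)) (restrict_bimodule h M)"
proof -
  let ?B = "hochschild_coboundaries (Suc (Suc n)) (restrict_bimodule h M)"
  obtain w where w: "w \<in> cochains n (restrict_bimodule h (coinduced_quotient M))"
    and f: "f = coboundary n (restrict_bimodule h (coinduced_quotient M)) w"
    using assms(3) by (auto simp: hochschild_coboundaries_def)
  have "connecting h f = - coboundary (Suc n) (restrict_bimodule h M) (connecting h w)"
    using coboundary_connecting[OF assms(1,2), of w n] cochainsD(1)[OF w] by (simp add: f)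
  moreover have "coboundary (Suc n) (restrict_bimodule h M) (connecting h w) \<in> ?B"
    using connecting_cochain[OF assms(1,2) w] by (simp add: hochschild_coboundaries_def)
  ultimately show ?thesis
    using complex_vector.subspace_neg[OF subspace_coboundaries[OF bimodule_restrict[OF assms(1,2)]]]
    by metis
qed

lemma to_quotient_unit: "bimodule M \<Longrightarrow> m \<in> carr M \<Longrightarrow> to_quotient M (\<lambda>y. lact M y m) = 0"
  by (simp add: to_quotient_def fun_eq_iff bimodule_act)

text \<open>
  Choose a primitive \<open>w\<close> of \<open>g\<close> in the coinduced bimodule and project it to the quotient. The
  connecting map sends the result to \<open>g\<close> up to the differential of \<open>w(\<dots>)(1)\<close>.
\<close>

lemma connecting_surjective:
  assumes M: "bimodule M" and h: "algebra_hom h" and r: "right_splitting h r"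
    and g: "g \<in> hochschild_cocycles (Suc n) (restrict_bimodule h M)"
  obtains f where "f \<in> hochschild_cocycles n (restrict_bimodule h (coinduced_quotient M))"
    and "g - connecting h f \<in> hochschild_coboundaries (Suc n) (restrict_bimodule h M)"
proof -
  let ?\<iota> = "\<lambda>m y. lact M y m"
  let ?J = "restrict_bimodule h (coinduced M)" and ?M = "restrict_bimodule h M"
    and ?Q = "restrict_bimodule h (coinduced_quotient M)"
  note J = bimodule_restrict[OF bimodule_coinduced[OF M] h]
  note p = bimodule_hom_restrict[OF to_quotient_hom[OF M], of h]
  have gM: "g ys \<in> carr M" for ys
    using g cochainsD(1)[of g "Suc n" ?M] by (simp add: hochschild_cocycles_def)
  have "?\<iota> \<circ> g \<in> hochschild_cocycles (Suc n) ?J"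
    by (rule cocycles_hom[OF bimodule_restrict[OF M h] bimodule_hom_restrict[OF coinduced_unit_hom[OF M]] g])
  then obtain w where w: "w \<in> cochains n ?J" and dw: "coboundary n ?J w = ?\<iota> \<circ> g"
    by (rule coinduced_acyclic[OF M h r])
  define f where "f = to_quotient M \<circ> w"
  define v where "v ys = w ys 1" for ys
  note wc = cochainsD(1)[OF w]
  have "coboundary n ?Q f = to_quotient M \<circ> (?\<iota> \<circ> g)"
    unfolding f_def coboundary_hom[OF J p wc] dw ..
  also have "\<dots> = 0" using to_quotient_unit[OF M gM] by (simp add: fun_eq_iff)
  finally have f: "f \<in> hochschild_cocycles n ?Q"
    using cochains_hom[OF J p w] by (simp add: hochschild_cocycles_def f_def)
  have v: "v \<in> cochains n ?M"
    unfolding v_def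
    using wc cochainsD(2)[OF w] clinear_apply[OF cochains_slot[OF w], of _ _ 1]
    by (intro cochainsI) simp_all
  have "g - connecting h f = coboundary n ?M v"
  proof
    fix as
    show "(g - connecting h f) as = coboundary n ?M v as"
    proof (cases "length as = n + 1")
      case True
      then obtain a bs where as: "as = a # bs" by (cases as) auto
      have "g as = coboundary n ?J w as 1" by (simp add: dw bimodule_act[OF M gM])
      then show ?thesis
        using True
        by (simp add: coboundary_bar_tail bar_tail_apply plus_fun_def as f_def to_quotient_def v_def[abs_def])
    next
      case False
      moreover have "g \<in> cochains (Suc n) ?M" using g by (simp add: hochschild_cocycles_def)
      moreover have "connecting h f \<in> cochains (Suc n) ?M"
        using f connecting_cochain[OF M h] by (simp add: hochschild_cocycles_def)
      ultimately show ?thesis by (simp add: cochainsD coboundary_wrong_length)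
    qed
  qed
  then have "g - connecting h f \<in> hochschild_coboundaries (Suc n) ?M"
    using v by (simp add: hochschild_coboundaries_def)
  with f show ?thesis by (rule that)
qed

text \<open>
  If the image of \<open>f\<close> is the differential of \<open>v\<close>, then \<open>f - v\<close> is a cocycle in the coinduced bimodule.
  A primitive of it projects to a primitive of \<open>f\<close>.
\<close>

lemma connecting_injective:
  assumes M: "bimodule M" and h: "algebra_hom h" and r: "right_splitting h r"
    and f: "f \<in> hochschild_cocycles (Suc n) (restrict_bimodule h (coinduced_quotient M))"
    and b: "connecting h f \<in> hochschild_coboundaries (Suc (Suc n)) (restrict_bimodule h M)"
  shows "f \<in> hochschild_coboundaries (Suc n) (restrict_bimodule h (coinduced_quotient M))"
proof -
  let ?\<iota> = "\<lambda>m y. lact M y m"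
  let ?J = "restrict_bimodule h (coinduced M)" and ?M = "restrict_bimodule h M"
    and ?Q = "restrict_bimodule h (coinduced_quotient M)"
  note J = bimodule_restrict[OF bimodule_coinduced[OF M] h]
  note p = bimodule_hom_restrict[OF to_quotient_hom[OF M], of h]
  note M' = bimodule_restrict[OF M h]
  note \<iota> = bimodule_hom_restrict[OF coinduced_unit_hom[OF M], of h]
  have fc: "f \<in> cochains (Suc n) ?Q" and fd: "coboundary (Suc n) ?Q f = 0"
    using f by (auto simp: hochschild_cocycles_def)
  obtain v where v: "v \<in> cochains (Suc n) ?M" and dv: "connecting h f = coboundary (Suc n) ?M v"
    using b by (auto simp: hochschild_coboundaries_def)
  have vM: "v ys \<in> carr M" for ys using cochainsD(1)[OF v] by simp
  have fJ: "f \<in> cochains (Suc n) ?J"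
    using cochainsD(1,2)[OF fc] cochains_slot[OF fc] by (intro cochainsI) simp_all
  have \<iota>v: "?\<iota> \<circ> v \<in> cochains (Suc n) ?J" by (rule cochains_hom[OF M' \<iota> v])
  have zc: "f + (-1) *\<^sub>C (?\<iota> \<circ> v) \<in> cochains (Suc n) ?J"
    using subspace_cochains[OF J] fJ \<iota>v complex_vector.subspace_add complex_vector.subspace_scale
    by metis
  have "coboundary (Suc n) ?J f = coboundary (Suc n) ?J (?\<iota> \<circ> v)"
    unfolding coboundary_coinduced_quotient[OF M fc] fd dv
    by (simp add: coboundary_hom[OF M' \<iota> cochainsD(1)[OF v]])
  moreover have "coboundary (Suc n) ?J (f + (-1) *\<^sub>C (?\<iota> \<circ> v)) =
      coboundary (Suc n) ?J f + coboundary (Suc n) ?J ((-1) *\<^sub>C (?\<iota> \<circ> v))"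
    by (rule coboundary_add[OF J cochainsD(1)[OF fJ] cochainsD(1)])
      (rule complex_vector.subspace_scale[OF subspace_cochains[OF J] \<iota>v])
  moreover have "coboundary (Suc n) ?J ((-1) *\<^sub>C (?\<iota> \<circ> v)) = (-1) *\<^sub>C coboundary (Suc n) ?J (?\<iota> \<circ> v)"
    by (rule coboundary_scale[OF J cochainsD(1)[OF \<iota>v]])
  ultimately have "coboundary (Suc n) ?J (f + (-1) *\<^sub>C (?\<iota> \<circ> v)) = 0" by simp
  with zc have "f + (-1) *\<^sub>C (?\<iota> \<circ> v) \<in> hochschild_cocycles (Suc n) ?J"
    by (simp add: hochschild_cocycles_def)
  then obtain w where w: "w \<in> cochains n ?J" and dw: "coboundary n ?J w = f + (-1) *\<^sub>C (?\<iota> \<circ> v)"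
    by (rule coinduced_acyclic[OF M h r])
  have "coboundary n ?Q (to_quotient M \<circ> w) = to_quotient M \<circ> coboundary n ?J w"
    by (rule coboundary_hom[OF J p cochainsD(1)[OF w]])
  also have "\<dots> = f"
  proof (rule ext, rule ext)
    fix as y
    have "f as 1 = 0" using cochainsD(1)[OF fc] by simp
    moreover have "lact M y (- v as) = - lact M y (v as)"
      using bimodule_act_diff(1)[OF M bimodule_carrier(1)[OF M] vM, of y as]
      by (simp add: bimodule_act_zero[OF M])
    ultimately show "(to_quotient M \<circ> coboundary n ?J w) as y = f as y"
      by (simp add: dw to_quotient_def bimodule_simps[OF M] vM)
  qed
  finally show ?thesis
    using cochains_hom[OF J p w] by (auto simp: hochschild_coboundaries_def)
qed

section \<open>Right actions and derivations of a free product\<close>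

definition right_action :: "('x::complex_algebra \<Rightarrow> 'w::complex_vector \<Rightarrow> 'w) \<Rightarrow> bool"
  where "right_action \<rho> \<longleftrightarrow>
    (\<forall>w. clinear (\<lambda>x. \<rho> x w)) \<and> (\<forall>x. clinear (\<rho> x)) \<and>
    (\<forall>w. \<rho> 1 w = w) \<and> (\<forall>x y w. \<rho> (x * y) w = \<rho> y (\<rho> x w))"

lemma right_actionD:
  assumes "right_action \<rho>"
  shows "\<rho> (x + y) w = \<rho> x w + \<rho> y w" and "\<rho> (c *\<^sub>C x) w = c *\<^sub>C \<rho> x w"
    and "\<rho> x (w + w') = \<rho> x w + \<rho> x w'" and "\<rho> x (c *\<^sub>C w) = c *\<^sub>C \<rho> x w"
    and "\<rho> 1 w = w" and "\<rho> (x * y) w = \<rho> y (\<rho> x w)"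
  using assms by (auto simp: right_action_def Vector_Spaces.linear_iff)

primrec fp_term_action ::
  "('a \<Rightarrow> 'w \<Rightarrow> 'w) \<Rightarrow> ('b \<Rightarrow> 'w \<Rightarrow> 'w) \<Rightarrow> ('a, 'b) fp_term \<Rightarrow> 'w \<Rightarrow> 'w::complex_vector"
where
  "fp_term_action \<alpha> \<beta> (FInl a) w = \<alpha> a w"
| "fp_term_action \<alpha> \<beta> (FInr b) w = \<beta> b w"
| "fp_term_action \<alpha> \<beta> (FAdd s t) w = fp_term_action \<alpha> \<beta> s w + fp_term_action \<alpha> \<beta> t w"
| "fp_term_action \<alpha> \<beta> (FMult s t) w = fp_term_action \<alpha> \<beta> t (fp_term_action \<alpha> \<beta> s w)"
| "fp_term_action \<alpha> \<beta> (FScale c t) w = c *\<^sub>C fp_term_action \<alpha> \<beta> t w"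

text \<open>
  Evaluating a formal algebra expression by the two given actions respects all relations of the free
  product. The order of composition is reversed on products because the actions are on the right.
\<close>

lemma free_product_right_action:
  fixes \<alpha> :: "'a::complex_algebra \<Rightarrow> 'w::complex_vector \<Rightarrow> 'w" and \<beta> :: "'b::complex_algebra \<Rightarrow> 'w \<Rightarrow> 'w"
  assumes "right_action \<alpha>" and "right_action \<beta>"
  obtains \<gamma> :: "('a, 'b) free_product \<Rightarrow> 'w \<Rightarrow> 'w" where "right_action \<gamma>"
    and "\<And>a. \<gamma> (fp_inl a) = \<alpha> a" and "\<And>b. \<gamma> (fp_inr b) = \<beta> b"
proof -
  let ?E = "fp_term_action \<alpha> \<beta>"
  note lin = right_actionD[OF assms(1)] right_actionD[OF assms(2)]
  have E_lin: "?E t (w + w') = ?E t w + ?E t w'" "?E t (c *\<^sub>C w) = c *\<^sub>C ?E t w" for t w w' c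
    by (induction t arbitrary: w w')
      (simp_all add: lin scaleC_add_right mult.commute)
  have \<alpha>0: "\<alpha> 0 w = 0" for w using lin(2)[of 0 0 w] by simp
  have E_eq: "?E s w = ?E t w" if "fp_eq s t" for s t w
    using that by (induction arbitrary: w rule: fp_eq.induct)
      (simp_all add: lin E_lin \<alpha>0 scaleC_add_left scaleC_add_right add.commute add.left_commute)
  define \<gamma> where "\<gamma> x = ?E (rep_free_product x)" for x
  have \<gamma>: "\<gamma> (abs_free_product t) = ?E t" for t
  proof
    fix w
    have "fp_eq t (rep_free_product (abs_free_product t))"
      using Quotient3_rep_abs[OF Quotient3_free_product] fp_eq.refl fp_eq.sym by metis
    then show "\<gamma> (abs_free_product t) w = ?E t w"
      unfolding \<gamma>_def by (rule E_eq[symmetric])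
  qed
  have add: "\<gamma> (x + y) w = \<gamma> x w + \<gamma> y w" for x y w
    by (induction x rule: free_product.abs_induct, induction y rule: free_product.abs_induct)
      (simp add: plus_free_product.abs_eq \<gamma>)
  have mult: "\<gamma> (x * y) w = \<gamma> y (\<gamma> x w)" for x y w
    by (induction x rule: free_product.abs_induct, induction y rule: free_product.abs_induct)
      (simp add: times_free_product.abs_eq \<gamma>)
  have scale: "\<gamma> (c *\<^sub>C x) w = c *\<^sub>C \<gamma> x w" for c x w
    by (induction x rule: free_product.abs_induct) (simp add: scaleC_free_product.abs_eq \<gamma>)
  have lin2: "clinear (\<gamma> x)" for x
    unfolding \<gamma>_def by (rule clinearI) (simp_all add: E_lin)
  have inl: "\<gamma> (fp_inl a) = \<alpha> a" and inr: "\<gamma> (fp_inr b) = \<beta> b" for a b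
    by (simp_all add: fun_eq_iff fp_inl.abs_eq fp_inr.abs_eq \<gamma>)
  have one: "\<gamma> 1 w = w" for w
    using inl[of 1] by (simp add: lin algebra_homD(2)[OF algebra_hom_fp_inl])
  have "right_action \<gamma>"
    unfolding right_action_def using lin2
    by (auto intro!: clinearI simp: add mult scale one)
  then show ?thesis using inl inr by (rule that)
qed

subsection \<open>Projectivity over the factors\<close>

lemma right_action_tensor:
  "right_action (\<lambda>(x::'x::complex_algebra) (w::('c::complex_algebra, 'x) tensor). w * (1 \<otimes> x))"
  unfolding right_action_def
proof (intro conjI allI clinearI)
  show "w * (1 \<otimes> 1) = w" for w :: "('c, 'x) tensor"
    using one_tensor_def by (metis mult.right_neutral)
  show "w * (1 \<otimes> (x * y)) = w * (1 \<otimes> x) * (1 \<otimes> y)" for w :: "('c, 'x) tensor" and x y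
    by (simp add: mult.assoc tensor_pure_mult)
qed (simp_all add: tensor_pure_add_right tensor_pure_scaleC_right semiring_class.distrib_left
      semiring_class.distrib_right mult_scaleC_left mult_scaleC_right)

text \<open>
  The maps \<open>\<sigma>\<close> and \<open>\<mu>\<close> split \<open>W\<close> into \<open>\<sigma> C\<close> and the kernel of \<open>\<mu>\<close>. Both summands are right
  \<open>Y\<close>-modules, the first through \<open>h\<close> and the second through \<open>\<epsilon>\<close>, and \<open>\<mu>\<close> is \<open>Y\<close>-linear.
\<close>

lemma right_action_through_augmentation:
  fixes \<mu> :: "'w::complex_vector \<Rightarrow> 'c::complex_algebra" and \<sigma> :: "'c \<Rightarrow> 'w"
    and h :: "'y::complex_algebra \<Rightarrow> 'c" and \<epsilon> :: "'y \<Rightarrow> complex"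
  assumes "clinear \<mu>" and "clinear \<sigma>" and "\<And>c. \<mu> (\<sigma> c) = c"
    and "algebra_hom h" and "algebra_hom \<epsilon>"
  shows "right_action (\<lambda>y w. \<sigma> (\<mu> w * h y) + \<epsilon> y *\<^sub>C (w - \<sigma> (\<mu> w)))"
    and "\<mu> (\<sigma> (\<mu> w * h y) + \<epsilon> y *\<^sub>C (w - \<sigma> (\<mu> w))) = \<mu> w * h y"
proof -
  note lin = clinear_add[OF assms(1)] clinear_scaleC[OF assms(1)] clinear_diff[OF assms(1)]
    clinear_add[OF assms(2)] clinear_scaleC[OF assms(2)] clinear_diff[OF assms(2)]
    clinear_add[OF algebra_homD(1)[OF assms(4)]] clinear_scaleC[OF algebra_homD(1)[OF assms(4)]]
    clinear_add[OF algebra_homD(1)[OF assms(5)]] clinear_scaleC[OF algebra_homD(1)[OF assms(5)]]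
  note hom = algebra_homD(2,3)[OF assms(4)] algebra_homD(2,3)[OF assms(5)]
  show \<mu>: "\<mu> (\<sigma> (\<mu> w * h y) + \<epsilon> y *\<^sub>C (w - \<sigma> (\<mu> w))) = \<mu> w * h y" for w y
    by (simp add: lin assms(3))
  show "right_action (\<lambda>y w. \<sigma> (\<mu> w * h y) + \<epsilon> y *\<^sub>C (w - \<sigma> (\<mu> w)))"
    unfolding right_action_def
  proof (intro conjI allI clinearI)
    fix x y w
    show "\<sigma> (\<mu> w * h (x * y)) + \<epsilon> (x * y) *\<^sub>C (w - \<sigma> (\<mu> w)) =
      \<sigma> (\<mu> (\<sigma> (\<mu> w * h x) + \<epsilon> x *\<^sub>C (w - \<sigma> (\<mu> w))) * h y) + \<epsilon> y *\<^sub>C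
        (\<sigma> (\<mu> w * h x) + \<epsilon> x *\<^sub>C (w - \<sigma> (\<mu> w)) - \<sigma> (\<mu> (\<sigma> (\<mu> w * h x) + \<epsilon> x *\<^sub>C (w - \<sigma> (\<mu> w)))))"
      unfolding \<mu> by (simp add: hom mult.assoc mult.commute[of "\<epsilon> x"])
  qed (simp_all add: lin hom semiring_class.distrib_left semiring_class.distrib_right mult_scaleC_left
        mult_scaleC_right scaleC_add_left scaleC_add_right scaleC_complex_def
        complex_vector.scale_right_diff_distrib algebra_simps scaleC_one)
qed

text \<open>
  If \<open>C\<close> acts on \<open>C \<otimes> X\<close> so that the multiplication map is \<open>C\<close>-linear, then acting on \<open>1 \<otimes> 1\<close> is a
  section of it; the section is \<open>X\<close>-linear if \<open>X \<rightarrow> C\<close> followed by the action is multiplication on the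
  right factor.
\<close>

lemma right_splitting_of_action:
  fixes k :: "'x::complex_algebra \<Rightarrow> 'c::complex_algebra" and \<gamma> :: "'c \<Rightarrow> ('c, 'x) tensor \<Rightarrow> ('c, 'x) tensor"
  assumes k: "algebra_hom k" and "right_action \<gamma>" and "\<And>x w. \<gamma> (k x) w = w * (1 \<otimes> x)"
    and "\<And>y w. tensor_lift (\<lambda>c x. c * k x) (\<gamma> y w) = tensor_lift (\<lambda>c x. c * k x) w * y"
  shows "right_splitting k (\<lambda>y. \<gamma> y (1 \<otimes> 1))"
  using assms(2-4) algebra_homD(2)[OF k]
  by (auto simp: right_splitting_def right_action_def tensor_lift_pure bilinear_map_hom_mult[OF k])

lemma tensor_mult_section:
  fixes k :: "'x::complex_algebra \<Rightarrow> 'c::complex_algebra"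
  assumes "algebra_hom k"
  defines "\<mu> \<equiv> tensor_lift (\<lambda>c x. c * k x)"
  shows "clinear \<mu>" and "clinear (\<lambda>c. c \<otimes> (1::'x))" and "\<mu> (c \<otimes> 1) = c" and "\<mu> (w * (1 \<otimes> x)) = \<mu> w * k x"
proof -
  note bil = bilinear_map_hom_mult[OF assms(1)]
  show "clinear \<mu>" unfolding \<mu>_def by (rule tensor_lift_linear[OF bil])
  show "clinear (\<lambda>c. c \<otimes> (1::'x))"
    by (rule clinearI) (simp_all add: tensor_pure_add_left tensor_pure_scaleC_left)
  show "\<mu> (c \<otimes> 1) = c" by (simp add: \<mu>_def tensor_lift_pure[OF bil] algebra_homD(2)[OF assms(1)])
  show "\<mu> (w * (1 \<otimes> x)) = \<mu> w * k x"
    unfolding \<mu>_def tensor_lift_mult_right[OF bil] tensor_lift_clinear[OF bil clinear_rmult, symmetric]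
    by (simp add: algebra_homD(3)[OF assms(1)] mult.assoc)
qed

lemma intertwine_free_product:
  assumes "right_action \<gamma>" and "clinear \<mu>"
    and "\<And>a w. \<mu> (\<gamma> (fp_inl a) w) = \<mu> w * fp_inl a" and "\<And>b w. \<mu> (\<gamma> (fp_inr b) w) = \<mu> w * fp_inr b"
  shows "\<mu> (\<gamma> y w) = \<mu> w * y"
  by (induction y arbitrary: w rule: free_product_induct)
    (simp_all add: assms(3,4) right_actionD[OF assms(1)] clinear_add[OF assms(2)] clinear_scaleC[OF assms(2)]
      semiring_class.distrib_left mult_scaleC_right mult.assoc)

text \<open>
  \<open>A * B\<close> is projective as a right \<open>A\<close>-module if \<open>B\<close> has an augmentation; the next lemma exchanges the
  two factors.
\<close>

lemma right_splitting_fp_inl: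
  fixes \<epsilon> :: "'b::complex_algebra \<Rightarrow> complex"
  assumes "algebra_hom \<epsilon>"
  obtains r where "right_splitting (fp_inl :: 'a::complex_algebra \<Rightarrow> ('a, 'b) free_product) r"
proof -
  let ?k = "fp_inl :: 'a \<Rightarrow> ('a, 'b) free_product"
  let ?\<mu> = "tensor_lift (\<lambda>c x. c * ?k x)"
  note sec = tensor_mult_section[OF algebra_hom_fp_inl]
  note aug = right_action_through_augmentation[OF sec(1,2,3) algebra_hom_fp_inr assms]
  obtain \<gamma> where \<gamma>: "right_action \<gamma>" "\<And>a. \<gamma> (?k a) = (\<lambda>w. w * (1 \<otimes> a))"
    "\<And>b. \<gamma> (fp_inr b) = (\<lambda>w. (?\<mu> w * fp_inr b) \<otimes> 1 + \<epsilon> b *\<^sub>C (w - ?\<mu> w \<otimes> 1))"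
    by (rule free_product_right_action[OF right_action_tensor aug(1)]) (rule that)
  have "?\<mu> (\<gamma> y w) = ?\<mu> w * y" for y w
    by (rule intertwine_free_product[OF \<gamma>(1) sec(1)]) (simp_all only: \<gamma>(2,3) sec(4) aug(2))
  then have "right_splitting ?k (\<lambda>y. \<gamma> y (1 \<otimes> 1))"
    using \<gamma>(1,2) by (intro right_splitting_of_action algebra_hom_fp_inl) simp_all
  then show ?thesis by (rule that)
qed

lemma right_splitting_fp_inr:
  fixes \<epsilon> :: "'a::complex_algebra \<Rightarrow> complex"
  assumes "algebra_hom \<epsilon>"
  obtains r where "right_splitting (fp_inr :: 'b::complex_algebra \<Rightarrow> ('a, 'b) free_product) r"
proof -
  let ?k = "fp_inr :: 'b \<Rightarrow> ('a, 'b) free_product"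
  let ?\<mu> = "tensor_lift (\<lambda>c x. c * ?k x)"
  note sec = tensor_mult_section[OF algebra_hom_fp_inr]
  note aug = right_action_through_augmentation[OF sec(1,2,3) algebra_hom_fp_inl assms]
  obtain \<gamma> where \<gamma>: "right_action \<gamma>"
    "\<And>a. \<gamma> (fp_inl a) = (\<lambda>w. (?\<mu> w * fp_inl a) \<otimes> 1 + \<epsilon> a *\<^sub>C (w - ?\<mu> w \<otimes> 1))"
    "\<And>b. \<gamma> (?k b) = (\<lambda>w. w * (1 \<otimes> b))"
    by (rule free_product_right_action[OF aug(1) right_action_tensor]) (rule that)
  have "?\<mu> (\<gamma> y w) = ?\<mu> w * y" for y w
    by (rule intertwine_free_product[OF \<gamma>(1) sec(1)]) (simp_all only: \<gamma>(2,3) sec(4) aug(2))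
  then have "right_splitting ?k (\<lambda>y. \<gamma> y (1 \<otimes> 1))"
    using \<gamma>(1,3) by (intro right_splitting_of_action algebra_hom_fp_inr) simp_all
  then show ?thesis by (rule that)
qed

subsection \<open>Derivations\<close>

definition derivation :: "('a::complex_algebra, 'm::complex_vector) bimod \<Rightarrow> ('a \<Rightarrow> 'm) \<Rightarrow> bool"
  where "derivation M D \<longleftrightarrow> clinear D \<and> range D \<subseteq> carr M \<and>
    (\<forall>x y. D (x * y) = lact M x (D y) + ract M (D x) y)"

lemma derivationD:
  assumes "derivation M D"
  shows "clinear D" and "D x \<in> carr M" and "D (x * y) = lact M x (D y) + ract M (D x) y"
    and "D (x + y) = D x + D y" and "D (c *\<^sub>C x) = c *\<^sub>C D x"
  using assms clinear_add[of D] clinear_scaleC[of D] by (auto simp: derivation_def)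

lemma derivation_one: "bimodule M \<Longrightarrow> derivation M D \<Longrightarrow> D 1 = 0"
  using derivationD(3)[of M D 1 1] derivationD(2)[of M D 1] by (simp add: bimodule_act)

primrec fp_term_derivation ::
  "(('a::complex_algebra, 'b::complex_algebra) free_product, 'm::complex_vector) bimod
    \<Rightarrow> ('a \<Rightarrow> 'm) \<Rightarrow> ('b \<Rightarrow> 'm) \<Rightarrow> ('a, 'b) fp_term \<Rightarrow> 'm"
where
  "fp_term_derivation M d e (FInl a) = d a"
| "fp_term_derivation M d e (FInr b) = e b"
| "fp_term_derivation M d e (FAdd s t) = fp_term_derivation M d e s + fp_term_derivation M d e t"
| "fp_term_derivation M d e (FMult s t) =
    lact M (abs_free_product s) (fp_term_derivation M d e t)
    + ract M (fp_term_derivation M d e s) (abs_free_product t)"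
| "fp_term_derivation M d e (FScale c t) = c *\<^sub>C fp_term_derivation M d e t"

text \<open>
  A derivation is determined on formal algebra expressions by the Leibniz rule. It respects the
  relations of the free product by the bimodule axioms. The relation that identifies the two units
  is respected because derivations vanish at \<open>1\<close>.
\<close>

lemma free_product_derivation:
  fixes M :: "(('a::complex_algebra, 'b::complex_algebra) free_product, 'm::complex_vector) bimod"
  assumes M: "bimodule M"
    and d: "derivation (restrict_bimodule fp_inl M) d" and e: "derivation (restrict_bimodule fp_inr M) e"
  obtains D where "derivation M D" and "\<And>a. D (fp_inl a) = d a" and "\<And>b. D (fp_inr b) = e b"
proof -
  let ?D = "fp_term_derivation M d e"
  note der = derivationD[OF d, simplified] derivationD[OF e, simplified]
  have d1: "d 1 = 0" by (rule derivation_one[OF bimodule_restrict[OF M algebra_hom_fp_inl] d])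
  have e1: "e 1 = 0" by (rule derivation_one[OF bimodule_restrict[OF M algebra_hom_fp_inr] e])
  have d0: "d 0 = 0" by (rule clinear_zero[OF der(1)])
  have carr: "?D t \<in> carr M" for t
    by (induction t) (simp_all add: der bimodule_carrier[OF M])
  have abs: "abs_free_product (FInl a) = fp_inl a" "abs_free_product (FInr b) = fp_inr b"
    "abs_free_product (FAdd s t) = abs_free_product s + abs_free_product t"
    "abs_free_product (FMult s t) = abs_free_product s * abs_free_product t"
    "abs_free_product (FScale c t) = c *\<^sub>C abs_free_product t" for a b s t c
    by (simp_all add: fp_inl.abs_eq fp_inr.abs_eq plus_free_product.abs_eq times_free_product.abs_eq
        scaleC_free_product.abs_eq)
  have abs_eq: "abs_free_product s = abs_free_product t" if "fp_eq s t" for s t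
    using that by (simp add: free_product.abs_eq_iff)
  have D_eq: "?D s = ?D t" if "fp_eq s t" for s t
    using that
    by (induction rule: fp_eq.induct)
      (simp_all add: abs_eq abs carr der d0 d1 e1 bimodule_simps[OF M] scaleC_add_left scaleC_add_right
         algebra_homD(2)[OF algebra_hom_fp_inl] add.commute add.left_commute)
  define D where "D x = ?D (rep_free_product x)" for x
  have D: "D (abs_free_product t) = ?D t" for t
    unfolding D_def
    by (rule D_eq) (metis Quotient3_rep_abs[OF Quotient3_free_product] fp_eq.refl)
  have "D (x + y) = D x + D y" for x y
    by (induction x rule: free_product.abs_induct, induction y rule: free_product.abs_induct)
      (simp flip: abs(3) add: D)
  moreover have "D (x * y) = lact M x (D y) + ract M (D x) y" for x y
    by (induction x rule: free_product.abs_induct, induction y rule: free_product.abs_induct)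
      (simp flip: abs(4) add: D)
  moreover have "D (c *\<^sub>C x) = c *\<^sub>C D x" for c x
    by (induction x rule: free_product.abs_induct) (simp flip: abs(5) add: D)
  ultimately have "derivation M D"
    unfolding derivation_def using carr by (auto intro!: clinearI simp: D_def)
  moreover have "D (fp_inl a) = d a" "D (fp_inr b) = e b" for a b
    by (simp_all flip: abs(1,2) add: D)
  ultimately show ?thesis by (rule that)
qed

lemma derivation_unique:
  fixes M :: "(('a::complex_algebra, 'b::complex_algebra) free_product, 'm::complex_vector) bimod"
  assumes "derivation M D" and "derivation M D'"
    and "\<And>a. D (fp_inl a) = D' (fp_inl a)" and "\<And>b. D (fp_inr b) = D' (fp_inr b)"
  shows "D = D'"
proof
  show "D x = D' x" for x
    by (induction x rule: free_product_induct)
      (simp_all add: assms(3,4) derivationD(3-5)[OF assms(1)] derivationD(3-5)[OF assms(2)])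
qed

lemma coboundary_0_1:
  "coboundary 0 M f [x] = lact M x (f []) - ract M (f []) x"
  "coboundary (Suc 0) M f [x, y] = lact M x (f [y]) - f [x * y] + ract M (f [x]) y"
  by (simp_all add: coboundary_def)

lemma derivation_of_cocycle:
  assumes "f \<in> hochschild_cocycles (Suc 0) M"
  shows "derivation M (\<lambda>x. f [x])"
proof -
  have f: "f \<in> cochains (Suc 0) M" and d: "coboundary (Suc 0) M f = 0"
    using assms by (auto simp: hochschild_cocycles_def)
  have "f [x * y] = lact M x (f [y]) + ract M (f [x]) y - coboundary (Suc 0) M f [x, y]" for x y
    by (simp add: coboundary_0_1)
  then have "f [x * y] = lact M x (f [y]) + ract M (f [x]) y" for x y
    by (simp add: d)
  then show ?thesis
    using cochainsD(1)[OF f] cochains_slot[OF f, of "[]" "[]"] by (auto simp: derivation_def)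
qed

definition cochain_of_map :: "('a \<Rightarrow> 'm::zero) \<Rightarrow> 'a list \<Rightarrow> 'm"
  where "cochain_of_map D as = (if length as = 1 then D (hd as) else 0)"

lemma cocycle_of_derivation:
  assumes "bimodule M" and "derivation M D"
  shows "cochain_of_map D \<in> hochschild_cocycles (Suc 0) M"
proof -
  have "cochain_of_map D \<in> cochains (Suc 0) M"
  proof (rule cochainsI)
    show "clinear (\<lambda>x. cochain_of_map D (as @ x # bs))" for as bs
      using derivationD(1)[OF assms(2)] by (cases as; cases bs) (simp_all add: cochain_of_map_def)
  qed (auto simp: cochain_of_map_def derivationD(2)[OF assms(2)] bimodule_carrier[OF assms(1)])
  moreover have "coboundary (Suc 0) M (cochain_of_map D) as = 0" for as
  proof (cases "length as = 2")
    case True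
    then obtain x y where "as = [x, y]" by (auto simp: length_Suc_conv numeral_2_eq_2)
    then show ?thesis
      by (simp add: coboundary_0_1 cochain_of_map_def derivationD(3)[OF assms(2)])
  qed (simp add: coboundary_wrong_length)
  ultimately show ?thesis by (auto simp: hochschild_cocycles_def fun_eq_iff)
qed

lemma cochain_1_eqI:
  assumes "f \<in> cochains (Suc 0) M" and "g \<in> cochains (Suc 0) N" and "\<And>x. f [x] = g [x]"
  shows "f = g"
proof
  show "f as = g as" for as
    using assms cochainsD(2)[OF assms(1), of as] cochainsD(2)[OF assms(2), of as]
    by (cases "length as = Suc 0") (auto simp: length_Suc_conv)
qed

lemma inner_cocycle:
  assumes "bimodule M" and "q \<in> cochains 0 M"
  shows "coboundary 0 M q \<in> hochschild_cocycles (Suc 0) M"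
proof -
  have q: "q [] \<in> carr M" using cochainsD(1)[OF assms(2)] .
  have "derivation M (\<lambda>x. lact M x (q []) - ract M (q []) x)"
    unfolding derivation_def
    using clinear_fun_diff[OF bimodule_linear[OF assms(1) q]]
    by (auto simp: bimodule_simps[OF assms(1)] q)
  moreover have "coboundary 0 M q = cochain_of_map (\<lambda>x. lact M x (q []) - ract M (q []) x)"
  proof
    show "coboundary 0 M q as = cochain_of_map (\<lambda>x. lact M x (q []) - ract M (q []) x) as" for as
      by (cases "length as = Suc 0")
        (auto simp: length_Suc_conv coboundary_0_1 cochain_of_map_def coboundary_wrong_length)
  qed
  ultimately show ?thesis using cocycle_of_derivation[OF assms(1)] by simp
qed

section \<open>Comparison by restriction\<close>

text \<open>
  Bijectivity of the restriction map on cohomology in terms of cocycles, which spares the induction on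
  the degree the handling of cosets.
\<close>

definition restriction_iso ::
  "nat \<Rightarrow> (('a::complex_algebra, 'b::complex_algebra) free_product, 'm::complex_vector) bimod \<Rightarrow> bool"
  where "restriction_iso n M \<longleftrightarrow>
    (\<forall>f \<in> hochschild_cocycles n M.
      f \<circ> map fp_inl \<in> hochschild_coboundaries n (restrict_bimodule fp_inl M) \<longrightarrow>
      f \<circ> map fp_inr \<in> hochschild_coboundaries n (restrict_bimodule fp_inr M) \<longrightarrow>
      f \<in> hochschild_coboundaries n M) \<and>
    (\<forall>u \<in> hochschild_cocycles n (restrict_bimodule fp_inl M).
      \<forall>v \<in> hochschild_cocycles n (restrict_bimodule fp_inr M).
      \<exists>f \<in> hochschild_cocycles n M.
        (f \<circ> map fp_inl) - u \<in> hochschild_coboundaries n (restrict_bimodule fp_inl M) \<and>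
        (f \<circ> map fp_inr) - v \<in> hochschild_coboundaries n (restrict_bimodule fp_inr M))"

lemma restriction_isoD:
  assumes "restriction_iso n M"
  shows "f \<in> hochschild_cocycles n M \<Longrightarrow>
      f \<circ> map fp_inl \<in> hochschild_coboundaries n (restrict_bimodule fp_inl M) \<Longrightarrow>
      f \<circ> map fp_inr \<in> hochschild_coboundaries n (restrict_bimodule fp_inr M) \<Longrightarrow>
      f \<in> hochschild_coboundaries n M"
    and "u \<in> hochschild_cocycles n (restrict_bimodule fp_inl M) \<Longrightarrow>
      v \<in> hochschild_cocycles n (restrict_bimodule fp_inr M) \<Longrightarrow>
      \<exists>f \<in> hochschild_cocycles n M.
        (f \<circ> map fp_inl) - u \<in> hochschild_coboundaries n (restrict_bimodule fp_inl M) \<and>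
        (f \<circ> map fp_inr) - v \<in> hochschild_coboundaries n (restrict_bimodule fp_inr M)"
  using assms by (auto simp: restriction_iso_def)

lemma free_product_glue_cocycles:
  fixes M :: "(('a::complex_algebra, 'b::complex_algebra) free_product, 'm::complex_vector) bimod"
  assumes M: "bimodule M"
    and u: "u \<in> hochschild_cocycles (Suc 0) (restrict_bimodule fp_inl M)"
    and v: "v \<in> hochschild_cocycles (Suc 0) (restrict_bimodule fp_inr M)"
  obtains f where "f \<in> hochschild_cocycles (Suc 0) M" and "f \<circ> map fp_inl = u" and "f \<circ> map fp_inr = v"
proof -
  obtain D where D: "derivation M D" "\<And>a. D (fp_inl a) = u [a]" "\<And>b. D (fp_inr b) = v [b]"
    by (rule free_product_derivation[OF M derivation_of_cocycle[OF u] derivation_of_cocycle[OF v]]) (rule that)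
  let ?f = "cochain_of_map D"
  have f: "?f \<in> hochschild_cocycles (Suc 0) M" by (rule cocycle_of_derivation[OF M D(1)])
  have fc: "?f \<in> cochains (Suc 0) M" using f by (simp add: hochschild_cocycles_def)
  have "?f \<circ> map fp_inl = u"
    using u D(2) by (intro cochain_1_eqI[OF cochains_restrict[OF algebra_hom_fp_inl fc]])
      (auto simp: hochschild_cocycles_def cochain_of_map_def)
  moreover have "?f \<circ> map fp_inr = v"
    using v D(3) by (intro cochain_1_eqI[OF cochains_restrict[OF algebra_hom_fp_inr fc]])
      (auto simp: hochschild_cocycles_def cochain_of_map_def)
  ultimately show ?thesis using f that by blast
qed

lemma free_product_cocycle_unique:
  fixes M :: "(('a::complex_algebra, 'b::complex_algebra) free_product, 'm::complex_vector) bimod"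
  assumes f: "f \<in> hochschild_cocycles (Suc 0) M" and g: "g \<in> hochschild_cocycles (Suc 0) M"
    and "f \<circ> map fp_inl = g \<circ> map fp_inl" and "f \<circ> map fp_inr = g \<circ> map fp_inr"
  shows "f = g"
proof -
  have "f [fp_inl a] = g [fp_inl a]" "f [fp_inr b] = g [fp_inr b]" for a b
    using fun_cong[OF assms(3), of "[a]"] fun_cong[OF assms(4), of "[b]"] by simp_all
  then have "(\<lambda>x. f [x]) = (\<lambda>x. g [x])"
    by (rule derivation_unique[OF derivation_of_cocycle[OF f] derivation_of_cocycle[OF g]])
  then show ?thesis
    using f g by (intro cochain_1_eqI[of f M g M]) (auto simp: hochschild_cocycles_def dest: fun_cong)
qed

lemma coboundaries_Suc: "hochschild_coboundaries (Suc n) M = coboundary n M ` cochains n M"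
  by (simp add: hochschild_coboundaries_def)

text \<open>
  The base of the induction. A derivation into the quotient that is inner on both factors lifts to a
  derivation into the acyclic coinduced bimodule, and so it is inner.
\<close>

lemma restriction_iso_quotient_1:
  fixes M :: "(('a::complex_algebra, 'b::complex_algebra) free_product, 'm::complex_vector) bimod"
  assumes M: "bimodule M"
  shows "restriction_iso (Suc 0) (coinduced_quotient M)"
  unfolding restriction_iso_def
proof (intro conjI ballI impI)
  let ?J = "coinduced M" and ?Q = "coinduced_quotient M"
  note J = bimodule_coinduced[OF M] and p = to_quotient_hom[OF M]
  fix f assume f: "f \<in> hochschild_cocycles (Suc 0) ?Q"
    and "f \<circ> map fp_inl \<in> hochschild_coboundaries (Suc 0) (restrict_bimodule fp_inl ?Q)"
    and "f \<circ> map fp_inr \<in> hochschild_coboundaries (Suc 0) (restrict_bimodule fp_inr ?Q)"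
  then obtain q r where q: "q \<in> cochains 0 (restrict_bimodule fp_inl ?Q)"
      and fq: "f \<circ> map fp_inl = coboundary 0 (restrict_bimodule fp_inl ?Q) q"
      and r: "r \<in> cochains 0 (restrict_bimodule fp_inr ?Q)"
      and fr: "f \<circ> map fp_inr = coboundary 0 (restrict_bimodule fp_inr ?Q) r"
    by (auto simp: coboundaries_Suc)
  \<comment> \<open>The quotient is modelled inside \<open>J\<close>, so an element of it is its own lift.\<close>
  have J0: "s \<in> cochains 0 (restrict_bimodule h ?J)" "to_quotient M \<circ> s = s"
    if s: "s \<in> cochains 0 (restrict_bimodule h ?Q)" for s and h :: "'x::complex_algebra \<Rightarrow> _"
  proof -
    show "s \<in> cochains 0 (restrict_bimodule h ?J)"
      using cochainsD(1,2)[OF s] cochains_slot[OF s] by (intro cochainsI) simp_all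
    show "to_quotient M \<circ> s = s"
      using cochainsD(1)[OF s] by (simp add: fun_eq_iff to_quotient_def bimodule_act_zero[OF M])
  qed
  obtain e where e: "e \<in> hochschild_cocycles (Suc 0) ?J"
    and eq: "e \<circ> map fp_inl = coboundary 0 (restrict_bimodule fp_inl ?J) q"
    and er: "e \<circ> map fp_inr = coboundary 0 (restrict_bimodule fp_inr ?J) r"
    by (rule free_product_glue_cocycles[OF J
        inner_cocycle[OF bimodule_restrict[OF J algebra_hom_fp_inl] J0(1)[OF q]]
        inner_cocycle[OF bimodule_restrict[OF J algebra_hom_fp_inr] J0(1)[OF r]]]) (rule that)
  obtain w where w: "w \<in> cochains 0 ?J" and dw: "coboundary 0 ?J w = e"
    by (rule coinduced_acyclic[OF M algebra_hom_id right_splitting_id, of e 0]) (simp_all add: e)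
  have pe: "to_quotient M \<circ> e \<in> hochschild_cocycles (Suc 0) ?Q"
    by (rule cocycles_hom[OF J p e])
  have "to_quotient M \<circ> e \<circ> map fp_inl = f \<circ> map fp_inl"
    using coboundary_hom[OF bimodule_restrict[OF J algebra_hom_fp_inl] bimodule_hom_restrict[OF p],
        of q 0, OF cochainsD(1)[OF J0(1)[OF q]]]
    by (simp add: comp_assoc eq fq J0(2)[OF q])
  moreover have "to_quotient M \<circ> e \<circ> map fp_inr = f \<circ> map fp_inr"
    using coboundary_hom[OF bimodule_restrict[OF J algebra_hom_fp_inr] bimodule_hom_restrict[OF p],
        of r 0, OF cochainsD(1)[OF J0(1)[OF r]]]
    by (simp add: comp_assoc er fr J0(2)[OF r])
  ultimately have "f = to_quotient M \<circ> coboundary 0 ?J w"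
    unfolding dw by (intro free_product_cocycle_unique[OF f pe]) simp_all
  also have "\<dots> = coboundary 0 ?Q (to_quotient M \<circ> w)"
    by (rule coboundary_hom[OF J p cochainsD(1)[OF w], symmetric])
  finally show "f \<in> hochschild_coboundaries (Suc 0) ?Q"
    using cochains_hom[OF J p w] by (simp add: coboundaries_Suc)
next
  fix u v
  assume "u \<in> hochschild_cocycles (Suc 0) (restrict_bimodule fp_inl (coinduced_quotient M))"
    and "v \<in> hochschild_cocycles (Suc 0) (restrict_bimodule fp_inr (coinduced_quotient M))"
  then obtain f where f: "f \<in> hochschild_cocycles (Suc 0) (coinduced_quotient M)"
      "f \<circ> map fp_inl = u" "f \<circ> map fp_inr = v"
    by (rule free_product_glue_cocycles[OF bimodule_coinduced_quotient[OF M]])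
  have "0 \<in> hochschild_coboundaries (Suc 0) (restrict_bimodule fp_inl (coinduced_quotient M))"
    "0 \<in> hochschild_coboundaries (Suc 0) (restrict_bimodule fp_inr (coinduced_quotient M))"
    using bimodule_restrict[OF bimodule_coinduced_quotient[OF M]] algebra_hom_fp_inl algebra_hom_fp_inr
    by (blast intro: complex_vector.subspace_0 subspace_coboundaries)+
  with f show "\<exists>f\<in>hochschild_cocycles (Suc 0) (coinduced_quotient M).
      (f \<circ> map fp_inl) - u \<in> hochschild_coboundaries (Suc 0) (restrict_bimodule fp_inl (coinduced_quotient M)) \<and>
      (f \<circ> map fp_inr) - v \<in> hochschild_coboundaries (Suc 0) (restrict_bimodule fp_inr (coinduced_quotient M))"
    by (intro bexI[of _ f]) simp_all
qed

lemma connecting_restrict: "connecting h (f \<circ> map h) = connecting id f \<circ> map h"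
  by (auto simp: fun_eq_iff connecting_def split: list.split)

lemma connecting_diff: "connecting h (f - g) = connecting h f - connecting h g"
  for f g :: "'a list \<Rightarrow> 'c \<Rightarrow> 'm::complex_vector"
  by (auto simp: fun_eq_iff connecting_def split: list.split)

text \<open>
  Both halves are diagram chases in the square formed by the connecting maps and the restriction maps.
  The square commutes on the level of cochains by \<open>connecting_restrict\<close>.
\<close>

lemma restriction_iso_Suc:
  fixes M :: "(('a::complex_algebra, 'b::complex_algebra) free_product, 'm::complex_vector) bimod"
  assumes M: "bimodule M"
    and rA: "right_splitting (fp_inl :: 'a \<Rightarrow> ('a, 'b) free_product) rA"
    and rB: "right_splitting (fp_inr :: 'b \<Rightarrow> ('a, 'b) free_product) rB"
    and iso: "restriction_iso (Suc n) (coinduced_quotient M)"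
  shows "restriction_iso (Suc (Suc n)) M"
  unfolding restriction_iso_def
proof (intro conjI ballI impI)
  let ?A = "fp_inl :: 'a \<Rightarrow> ('a, 'b) free_product" and ?B = "fp_inr :: 'b \<Rightarrow> ('a, 'b) free_product"
  note A = algebra_hom_fp_inl and B = algebra_hom_fp_inr
  note Q = bimodule_coinduced_quotient[OF M]
  note sub = subspace_coboundaries[OF M] subspace_coboundaries[OF bimodule_restrict[OF M A]]
    subspace_coboundaries[OF bimodule_restrict[OF M B]]
  {
    fix g assume g: "g \<in> hochschild_cocycles (Suc (Suc n)) M"
      and gA: "g \<circ> map ?A \<in> hochschild_coboundaries (Suc (Suc n)) (restrict_bimodule ?A M)"
      and gB: "g \<circ> map ?B \<in> hochschild_coboundaries (Suc (Suc n)) (restrict_bimodule ?B M)"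
    obtain f where f: "f \<in> hochschild_cocycles (Suc n) (coinduced_quotient M)"
      and gf: "g - connecting id f \<in> hochschild_coboundaries (Suc (Suc n)) M"
      by (rule connecting_surjective[OF M algebra_hom_id right_splitting_id, of g "Suc n"])
        (simp_all add: g)
    have "connecting ?A (f \<circ> map ?A) = (g \<circ> map ?A) - ((g - connecting id f) \<circ> map ?A)"
      by (simp add: connecting_restrict fun_eq_iff)
    also have "\<dots> \<in> hochschild_coboundaries (Suc (Suc n)) (restrict_bimodule ?A M)"
      by (rule complex_vector.subspace_diff[OF sub(2) gA coboundaries_restrict[OF A gf]])
    finally have fA: "f \<circ> map ?A \<in> hochschild_coboundaries (Suc n) (restrict_bimodule ?A (coinduced_quotient M))"
      by (rule connecting_injective[OF M A rA cocycles_restrict[OF A f]])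
    have "connecting ?B (f \<circ> map ?B) = (g \<circ> map ?B) - ((g - connecting id f) \<circ> map ?B)"
      by (simp add: connecting_restrict fun_eq_iff)
    also have "\<dots> \<in> hochschild_coboundaries (Suc (Suc n)) (restrict_bimodule ?B M)"
      by (rule complex_vector.subspace_diff[OF sub(3) gB coboundaries_restrict[OF B gf]])
    finally have fB: "f \<circ> map ?B \<in> hochschild_coboundaries (Suc n) (restrict_bimodule ?B (coinduced_quotient M))"
      by (rule connecting_injective[OF M B rB cocycles_restrict[OF B f]])
    have "f \<in> hochschild_coboundaries (Suc n) (coinduced_quotient M)"
      by (rule restriction_isoD(1)[OF iso f fA fB])
    then have "connecting id f \<in> hochschild_coboundaries (Suc (Suc n)) M"
      using connecting_coboundary[OF M algebra_hom_id, of f n] by simp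
    then show "g \<in> hochschild_coboundaries (Suc (Suc n)) M"
      using complex_vector.subspace_add[OF sub(1) gf, of "connecting id f"] by simp
  next
    fix u v
    assume "u \<in> hochschild_cocycles (Suc (Suc n)) (restrict_bimodule ?A M)"
      and "v \<in> hochschild_cocycles (Suc (Suc n)) (restrict_bimodule ?B M)"
    then obtain u' v' where u': "u' \<in> hochschild_cocycles (Suc n) (restrict_bimodule ?A (coinduced_quotient M))"
      and uu': "u - connecting ?A u' \<in> hochschild_coboundaries (Suc (Suc n)) (restrict_bimodule ?A M)"
      and v': "v' \<in> hochschild_cocycles (Suc n) (restrict_bimodule ?B (coinduced_quotient M))"
      and vv': "v - connecting ?B v' \<in> hochschild_coboundaries (Suc (Suc n)) (restrict_bimodule ?B M)"
      using connecting_surjective[OF M A rA] connecting_surjective[OF M B rB] by metis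
    then obtain f where f: "f \<in> hochschild_cocycles (Suc n) (coinduced_quotient M)"
      and fu: "(f \<circ> map ?A) - u' \<in> hochschild_coboundaries (Suc n) (restrict_bimodule ?A (coinduced_quotient M))"
      and fv: "(f \<circ> map ?B) - v' \<in> hochschild_coboundaries (Suc n) (restrict_bimodule ?B (coinduced_quotient M))"
      using restriction_isoD(2)[OF iso] by metis
    have "connecting id f \<in> hochschild_cocycles (Suc (Suc n)) M"
      using connecting_cocycle[OF M algebra_hom_id, of f "Suc n"] f by simp
    moreover have "(connecting id f \<circ> map ?A) - u \<in> hochschild_coboundaries (Suc (Suc n)) (restrict_bimodule ?A M)"
    proof -
      have "(connecting id f \<circ> map ?A) - u = connecting ?A ((f \<circ> map ?A) - u') - (u - connecting ?A u')"
        by (simp add: connecting_diff connecting_restrict)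
      then show ?thesis
        using complex_vector.subspace_diff[OF sub(2) connecting_coboundary[OF M A fu] uu'] by (simp only:)
    qed
    moreover have "(connecting id f \<circ> map ?B) - v \<in> hochschild_coboundaries (Suc (Suc n)) (restrict_bimodule ?B M)"
    proof -
      have "(connecting id f \<circ> map ?B) - v = connecting ?B ((f \<circ> map ?B) - v') - (v - connecting ?B v')"
        by (simp add: connecting_diff connecting_restrict)
      then show ?thesis
        using complex_vector.subspace_diff[OF sub(3) connecting_coboundary[OF M B fv] vv'] by (simp only:)
    qed
    ultimately show "\<exists>f\<in>hochschild_cocycles (Suc (Suc n)) M.
        (f \<circ> map ?A) - u \<in> hochschild_coboundaries (Suc (Suc n)) (restrict_bimodule ?A M) \<and>
        (f \<circ> map ?B) - v \<in> hochschild_coboundaries (Suc (Suc n)) (restrict_bimodule ?B M)"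
      by blast
  }
qed

subsection \<open>All degrees\<close>

text \<open>
  The property is inherited by retracts, by naturality of the restriction map in the coefficients.
\<close>

lemma restriction_iso_retract:
  fixes M :: "(('a::complex_algebra, 'b::complex_algebra) free_product, 'm::complex_vector) bimod"
    and N :: "(('a, 'b) free_product, 'n::complex_vector) bimod"
  assumes M: "bimodule M" and N: "bimodule N"
    and \<phi>: "bimodule_hom M N \<phi>" and \<psi>: "bimodule_hom N M \<psi>"
    and \<psi>\<phi>: "\<And>m. m \<in> carr M \<Longrightarrow> \<psi> (\<phi> m) = m"
    and iso: "restriction_iso n N"
  shows "restriction_iso n M"
  unfolding restriction_iso_def
proof (intro conjI ballI impI)
  note A = algebra_hom_fp_inl and B = algebra_hom_fp_inr
  have retract: "\<psi> \<circ> (\<phi> \<circ> f) = f" if "\<And>as. f as \<in> carr M" for f :: "'x list \<Rightarrow> 'm"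
    using that by (simp add: fun_eq_iff \<psi>\<phi>)
  {
    fix f assume f: "f \<in> hochschild_cocycles n M"
      and fA: "f \<circ> map fp_inl \<in> hochschild_coboundaries n (restrict_bimodule fp_inl M)"
      and fB: "f \<circ> map fp_inr \<in> hochschild_coboundaries n (restrict_bimodule fp_inr M)"
    have "\<phi> \<circ> f \<in> hochschild_coboundaries n N"
      using restriction_isoD(1)[OF iso cocycles_hom[OF M \<phi> f]]
        coboundaries_hom[OF bimodule_restrict[OF M A] bimodule_hom_restrict[OF \<phi>] fA]
        coboundaries_hom[OF bimodule_restrict[OF M B] bimodule_hom_restrict[OF \<phi>] fB]
      by (simp add: comp_assoc)
    then have "\<psi> \<circ> (\<phi> \<circ> f) \<in> hochschild_coboundaries n M"
      by (rule coboundaries_hom[OF N \<psi>])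
    moreover have "f as \<in> carr M" for as
      using f cochainsD(1) by (auto simp: hochschild_cocycles_def)
    ultimately show "f \<in> hochschild_coboundaries n M" by (simp add: retract)
  next
    fix u v assume u: "u \<in> hochschild_cocycles n (restrict_bimodule fp_inl M)"
      and v: "v \<in> hochschild_cocycles n (restrict_bimodule fp_inr M)"
    have uM: "u as \<in> carr M" and vM: "v bs \<in> carr M" for as bs
      using u v cochainsD(1)[of u n "restrict_bimodule fp_inl M"]
        cochainsD(1)[of v n "restrict_bimodule fp_inr M"]
      by (auto simp: hochschild_cocycles_def)
    obtain g where g: "g \<in> hochschild_cocycles n N"
      and gu: "(g \<circ> map fp_inl) - (\<phi> \<circ> u) \<in> hochschild_coboundaries n (restrict_bimodule fp_inl N)"
      and gv: "(g \<circ> map fp_inr) - (\<phi> \<circ> v) \<in> hochschild_coboundaries n (restrict_bimodule fp_inr N)"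
      using restriction_isoD(2)[OF iso
          cocycles_hom[OF bimodule_restrict[OF M A] bimodule_hom_restrict[OF \<phi>] u]
          cocycles_hom[OF bimodule_restrict[OF M B] bimodule_hom_restrict[OF \<phi>] v]] by blast
    have gN: "g as \<in> carr N" for as
      using g cochainsD(1) by (auto simp: hochschild_cocycles_def)
    have "((\<psi> \<circ> g) \<circ> map fp_inl) - u = \<psi> \<circ> ((g \<circ> map fp_inl) - (\<phi> \<circ> u))"
      "((\<psi> \<circ> g) \<circ> map fp_inr) - v = \<psi> \<circ> ((g \<circ> map fp_inr) - (\<phi> \<circ> v))"
      using gN uM vM bimodule_homD(1)[OF \<phi>]
      by (simp_all add: fun_eq_iff bimodule_hom_diff[OF N \<psi>] \<psi>\<phi>)
    then show "\<exists>f\<in>hochschild_cocycles n M.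
        (f \<circ> map fp_inl) - u \<in> hochschild_coboundaries n (restrict_bimodule fp_inl M) \<and>
        (f \<circ> map fp_inr) - v \<in> hochschild_coboundaries n (restrict_bimodule fp_inr M)"
      using cocycles_hom[OF N \<psi> g]
        coboundaries_hom[OF bimodule_restrict[OF N A] bimodule_hom_restrict[OF \<psi>] gu]
        coboundaries_hom[OF bimodule_restrict[OF N B] bimodule_hom_restrict[OF \<psi>] gv]
      by (metis)
  }
qed

text \<open>
  The dimension shift replaces the coefficient type \<open>'m\<close> by \<open>'c \<Rightarrow> 'm\<close>, while the type is fixed in an
  induction on the degree. The induction is therefore carried out for coefficients in
  \<open>'c list \<Rightarrow> 'm\<close>, a type that contains a copy of the functions from \<open>'c\<close> into itself and a copy of \<open>'m\<close>.
  Bimodules are transported along such embeddings.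
\<close>

definition encode_bimodule :: "('m \<Rightarrow> 'n) \<Rightarrow> ('n \<Rightarrow> 'm) \<Rightarrow> ('c, 'm) bimod \<Rightarrow> ('c, 'n) bimod"
  where "encode_bimodule enc dec M =
    \<lparr>carr = enc ` carr M, lact = (\<lambda>c n. enc (lact M c (dec n))), ract = (\<lambda>n c. enc (ract M (dec n) c))\<rparr>"

lemma encode_bimodule:
  fixes enc :: "'m::complex_vector \<Rightarrow> 'n::complex_vector" and dec :: "'n \<Rightarrow> 'm"
    and M :: "('c::complex_algebra, 'm) bimod"
  assumes M: "bimodule M" and enc: "clinear enc" and dec: "clinear dec" and inv: "\<And>m. dec (enc m) = m"
  shows "bimodule (encode_bimodule enc dec M)"
    and "bimodule_hom M (encode_bimodule enc dec M) enc"
    and "bimodule_hom (encode_bimodule enc dec M) M dec"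
proof -
  note lin = clinear_add[OF enc] clinear_scaleC[OF enc] clinear_add[OF dec] clinear_scaleC[OF dec]
  let ?N = "encode_bimodule enc dec M"
  have N: "carr ?N = enc ` carr M" "lact ?N c n = enc (lact M c (dec n))" "ract ?N n c = enc (ract M (dec n) c)"
    for c n
    by (simp_all add: encode_bimodule_def)
  show "bimodule ?N"
  proof (rule bimoduleI)
    show "complex_vector.subspace (carr ?N)"
      unfolding N complex_vector.subspace_def
    proof (intro conjI ballI allI)
      show "0 \<in> enc ` carr M"
        using bimodule_carrier(1)[OF M] clinear_zero[OF enc] by (metis imageI)
      show "x + y \<in> enc ` carr M" if "x \<in> enc ` carr M" "y \<in> enc ` carr M" for x y
        using that bimodule_carrier(2)[OF M] by (auto simp flip: lin(1))
      show "k *\<^sub>C x \<in> enc ` carr M" if "x \<in> enc ` carr M" for x k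
        using that bimodule_carrier(5)[OF M] by (auto simp flip: lin(2))
    qed
    fix n assume "n \<in> carr ?N"
    then have "dec n \<in> carr M" by (auto simp: N inv)
    then show "clinear (\<lambda>c. lact ?N c n)" "clinear (\<lambda>c. ract ?N n c)"
      unfolding N using clinear_comp[OF enc] bimodule_linear[OF M] by blast+
  qed (auto simp: N inv lin bimodule_simps[OF M] simp flip: lin(1,2))
  show "bimodule_hom M ?N enc" "bimodule_hom ?N M dec"
    by (auto simp: bimodule_hom_def N inv lin bimodule_simps[OF M])
qed

lemma restriction_iso_encode:
  fixes enc :: "'m::complex_vector \<Rightarrow> 'n::complex_vector" and dec :: "'n \<Rightarrow> 'm"
    and M :: "(('a::complex_algebra, 'b::complex_algebra) free_product, 'm) bimod"
  assumes "bimodule M" and "clinear enc" and "clinear dec" and "\<And>m. dec (enc m) = m"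
    and "\<And>N :: (('a, 'b) free_product, 'n) bimod. bimodule N \<Longrightarrow> restriction_iso n N"
  shows "restriction_iso n M"
  using encode_bimodule[OF assms(1-4)] assms(4,5) restriction_iso_retract[OF assms(1)] by metis

lemma restriction_iso_list_coefficients:
  fixes M :: "(('a::complex_algebra, 'b::complex_algebra) free_product,
      ('a, 'b) free_product list \<Rightarrow> 'm::complex_vector) bimod"
  assumes rA: "right_splitting (fp_inl :: 'a \<Rightarrow> ('a, 'b) free_product) rA"
    and rB: "right_splitting (fp_inr :: 'b \<Rightarrow> ('a, 'b) free_product) rB"
    and M: "bimodule M"
  shows "restriction_iso (Suc (Suc n)) M"
  using M
proof (induction n arbitrary: M)
  case 0
  then show ?case by (intro restriction_iso_Suc[OF _ rA rB] restriction_iso_quotient_1)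
next
  case (Suc n)
  \<comment> \<open>The function argument is put in front of the list; the value at the empty list is left over.\<close>
  define enc :: "(('a, 'b) free_product \<Rightarrow> ('a, 'b) free_product list \<Rightarrow> 'm) \<Rightarrow>
      ('a, 'b) free_product list \<Rightarrow> 'm"
    where "enc f = (\<lambda>xs. case xs of [] \<Rightarrow> 0 | x # xs' \<Rightarrow> f x xs')" for f
  define dec :: "(('a, 'b) free_product list \<Rightarrow> 'm) \<Rightarrow>
      (('a, 'b) free_product \<Rightarrow> ('a, 'b) free_product list \<Rightarrow> 'm)"
    where "dec g = (\<lambda>x xs. g (x # xs))" for g
  have "clinear enc"
    by (rule clinearI) (auto simp: enc_def fun_eq_iff plus_fun_def split: list.split)
  moreover have "clinear dec"
    by (rule clinearI) (auto simp: dec_def fun_eq_iff plus_fun_def)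
  moreover have "dec (enc f) = f" for f by (simp add: enc_def dec_def)
  ultimately have "restriction_iso (Suc (Suc n)) (coinduced_quotient M)"
    using Suc.IH by (rule restriction_iso_encode[OF bimodule_coinduced_quotient[OF Suc.prems]])
  then show ?case by (rule restriction_iso_Suc[OF Suc.prems rA rB])
qed

lemma restriction_iso_free_product:
  fixes M :: "(('a::complex_algebra, 'b::complex_algebra) free_product, 'm::complex_vector) bimod"
    and \<epsilon>A :: "'a \<Rightarrow> complex" and \<epsilon>B :: "'b \<Rightarrow> complex"
  assumes "algebra_hom \<epsilon>A" and "algebra_hom \<epsilon>B" and "bimodule M" and "n \<ge> 2"
  shows "restriction_iso n M"
proof -
  obtain rA where rA: "right_splitting (fp_inl :: 'a \<Rightarrow> ('a, 'b) free_product) rA"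
    by (rule right_splitting_fp_inl[OF assms(2)])
  obtain rB where rB: "right_splitting (fp_inr :: 'b \<Rightarrow> ('a, 'b) free_product) rB"
    by (rule right_splitting_fp_inr[OF assms(1)])
  obtain k where n: "n = Suc (Suc k)" using assms(4) by (metis add_2_eq_Suc le_Suc_ex)
  have enc: "clinear (\<lambda>(m::'m) (xs::('a, 'b) free_product list). m)"
    by (rule clinearI) (auto simp: fun_eq_iff plus_fun_def)
  have dec: "clinear (\<lambda>f :: ('a, 'b) free_product list \<Rightarrow> 'm. f [])"
    by (rule clinearI) auto
  show ?thesis
    unfolding n
    by (rule restriction_iso_encode[OF assms(3) enc dec])
      (simp_all add: restriction_iso_list_coefficients[OF rA rB])
qed

section \<open>Passage to cohomology\<close>

lemma coset_eq_iff:
  assumes "complex_vector.subspace B"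
  shows "z +o B = z' +o B \<longleftrightarrow> z - z' \<in> B"
proof
  assume "z +o B = z' +o B"
  moreover have "z \<in> z +o B"
    using complex_vector.subspace_0[OF assms] by (force simp: elt_set_plus_def)
  ultimately show "z - z' \<in> B" by (auto simp: elt_set_plus_def)
next
  have *: "x +o B \<subseteq> y +o B" if "x - y \<in> B" for x y
    using complex_vector.subspace_add[OF assms that]
    by (auto simp: elt_set_plus_def intro!: bexI[of _ "x - y + b" for b])
  assume "z - z' \<in> B"
  moreover from this have "z' - z \<in> B" using complex_vector.subspace_neg[OF assms] by fastforce
  ultimately show "z +o B = z' +o B" using * by blast
qed

lemma coset_add:
  assumes "complex_vector.subspace B"
  shows "(z +o B) + (z' +o B) = (z + z') +o B"
proof -
  have "B + B = B"
    using complex_vector.subspace_add[OF assms] complex_vector.subspace_0[OF assms]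
    by (force simp: set_plus_def)
  then show ?thesis by (simp add: set_plus_rearrange)
qed

lemma coset_image:
  assumes "complex_vector.subspace B" and "complex_vector.subspace B'"
    and "\<And>b. b \<in> B \<Longrightarrow> L (z + b) = L z + L b" and "\<And>b. b \<in> B \<Longrightarrow> L b \<in> B'"
  shows "L ` (z +o B) + B' = L z +o B'"
proof
  show "L ` (z +o B) + B' \<subseteq> L z +o B'"
    using assms(3,4) complex_vector.subspace_add[OF assms(2)]
    by (fastforce simp: set_plus_def elt_set_plus_def add.assoc)
  have "L z \<in> L ` (z +o B)"
    using complex_vector.subspace_0[OF assms(1)] by (force simp: elt_set_plus_def)
  then show "L z +o B' \<subseteq> L ` (z +o B) + B'"
    by (auto simp: set_plus_def elt_set_plus_def)
qed

lemma coboundaries_in_carrier: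
  assumes "bimodule M" and "f \<in> hochschild_coboundaries n M"
  shows "f as \<in> carr M"
proof (cases n)
  case 0
  then show ?thesis using assms by (simp add: hochschild_coboundaries_def bimodule_carrier)
next
  case (Suc k)
  then obtain g where g: "g \<in> cochains k M" "f = coboundary k M g"
    using assms(2) by (auto simp: coboundaries_Suc)
  then show ?thesis
    using bimodule_carrier[OF assms(1)] bar_tail_in_carrier[OF assms(1)] cochainsD(1)[OF g(1)]
    by (cases "length as = k + 1") (simp_all add: coboundary_bar_tail coboundary_wrong_length)
qed

lemma hochschild_map_coset:
  assumes M: "bimodule M" and N: "bimodule N" and f: "bimodule_hom M N f" and z: "z \<in> hochschild_cocycles n M"
  shows "hochschild_map n N f (z +o hochschild_coboundaries n M) = (f \<circ> z) +o hochschild_coboundaries n N"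
  unfolding hochschild_map_def
proof (rule coset_image[OF subspace_coboundaries[OF M] subspace_coboundaries[OF N]])
  fix b assume b: "b \<in> hochschild_coboundaries n M"
  show "f \<circ> b \<in> hochschild_coboundaries n N" by (rule coboundaries_hom[OF M f b])
  have "z as \<in> carr M" for as using z cochainsD(1) by (auto simp: hochschild_cocycles_def)
  then show "f \<circ> (z + b) = (f \<circ> z) + (f \<circ> b)"
    using coboundaries_in_carrier[OF M b] by (simp add: fun_eq_iff bimodule_homD(2)[OF f])
qed

definition restriction_map ::
  "nat \<Rightarrow> (('a::complex_algebra, 'b::complex_algebra) free_product, 'm::complex_vector) bimod \<Rightarrow>
    (('a, 'b) free_product list \<Rightarrow> 'm) set \<Rightarrow> ('a list \<Rightarrow> 'm) set \<times> ('b list \<Rightarrow> 'm) set"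
  where "restriction_map n M X =
    ((\<lambda>f. f \<circ> map fp_inl) ` X + hochschild_coboundaries n (restrict_bimodule fp_inl M),
     (\<lambda>f. f \<circ> map fp_inr) ` X + hochschild_coboundaries n (restrict_bimodule fp_inr M))"

lemma restriction_map_coset:
  assumes "bimodule M"
  shows "restriction_map n M (z +o hochschild_coboundaries n M) =
    ((z \<circ> map fp_inl) +o hochschild_coboundaries n (restrict_bimodule fp_inl M),
     (z \<circ> map fp_inr) +o hochschild_coboundaries n (restrict_bimodule fp_inr M))"
proof -
  note A = algebra_hom_fp_inl and B = algebra_hom_fp_inr
  note sub = subspace_coboundaries[OF assms] subspace_coboundaries[OF bimodule_restrict[OF assms A]]
    subspace_coboundaries[OF bimodule_restrict[OF assms B]]
  show ?thesis
    unfolding restriction_map_def prod.inject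
  proof
    show "(\<lambda>f. f \<circ> map fp_inl) ` (z +o hochschild_coboundaries n M)
        + hochschild_coboundaries n (restrict_bimodule fp_inl M) =
      (z \<circ> map fp_inl) +o hochschild_coboundaries n (restrict_bimodule fp_inl M)"
      by (rule coset_image[OF sub(1,2) _ coboundaries_restrict[OF A]]) (simp_all add: fun_eq_iff)
    show "(\<lambda>f. f \<circ> map fp_inr) ` (z +o hochschild_coboundaries n M)
        + hochschild_coboundaries n (restrict_bimodule fp_inr M) =
      (z \<circ> map fp_inr) +o hochschild_coboundaries n (restrict_bimodule fp_inr M)"
      by (rule coset_image[OF sub(1,3) _ coboundaries_restrict[OF B]]) (simp_all add: fun_eq_iff)
  qed
qed

lemma linear_iso_restriction_map:
  fixes M :: "(('a::complex_algebra, 'b::complex_algebra) free_product, 'm::complex_vector) bimod"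
  assumes M: "bimodule M" and iso: "restriction_iso n M"
  shows "linear_iso (hochschild_cohomology n M)
    (direct_sum (hochschild_cohomology n (restrict_bimodule fp_inl M))
      (hochschild_cohomology n (restrict_bimodule fp_inr M)))
    (restriction_map n M)"
proof -
  let ?MA = "restrict_bimodule fp_inl M" and ?MB = "restrict_bimodule fp_inr M"
  let ?BM = "hochschild_coboundaries n M" and ?ZM = "hochschild_cocycles n M"
  let ?BA = "hochschild_coboundaries n ?MA" and ?BB = "hochschild_coboundaries n ?MB"
  note A = algebra_hom_fp_inl and B = algebra_hom_fp_inr
  note MA = bimodule_restrict[OF M A] and MB = bimodule_restrict[OF M B]
  note sub = subspace_coboundaries[OF M] subspace_coboundaries[OF MA] subspace_coboundaries[OF MB]
  note coset = restriction_map_coset[OF M]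
  have scale: "scaleC c ` (z +o hochschild_coboundaries n N) + hochschild_coboundaries n N =
      (c *\<^sub>C z) +o hochschild_coboundaries n N" if "bimodule N"
    for c z and N :: "('x::complex_algebra, 'm) bimod"
    by (rule coset_image[OF subspace_coboundaries[OF that] subspace_coboundaries[OF that]])
      (simp_all add: scaleC_add_right complex_vector.subspace_scale[OF subspace_coboundaries[OF that]])
  have comp: "(f + g) \<circ> k = (f \<circ> k) + (g \<circ> k)" "(c *\<^sub>C f) \<circ> k = c *\<^sub>C (f \<circ> k)" "(f - g) \<circ> k = (f \<circ> k) - (g \<circ> k)"
    for f g :: "'x \<Rightarrow> 'm" and k :: "'y \<Rightarrow> 'x" and c
    by (simp_all add: fun_eq_iff)
  note simps = hochschild_cohomology_def quotient_space_def direct_sum_def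
  show ?thesis
    unfolding linear_iso_def bij_betw_def
  proof (intro conjI ballI allI)
    show "inj_on (restriction_map n M) (vcarr (hochschild_cohomology n M))"
    proof (rule inj_onI)
      fix X Y assume "X \<in> vcarr (hochschild_cohomology n M)" "Y \<in> vcarr (hochschild_cohomology n M)"
        and eq: "restriction_map n M X = restriction_map n M Y"
      then obtain x y where X: "X = x +o ?BM" and Y: "Y = y +o ?BM" and xy: "x \<in> ?ZM" "y \<in> ?ZM"
        by (auto simp: simps)
      have "(x - y) \<circ> map fp_inl \<in> ?BA" "(x - y) \<circ> map fp_inr \<in> ?BB"
        using eq by (simp_all add: X Y coset coset_eq_iff[OF sub(2)] coset_eq_iff[OF sub(3)] comp)
      then have "x - y \<in> ?BM"
        by (rule restriction_isoD(1)[OF iso complex_vector.subspace_diff[OF subspace_cocycles[OF M] xy]])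
      then show "X = Y" by (simp add: X Y coset_eq_iff[OF sub(1)])
    qed
    show "restriction_map n M ` vcarr (hochschild_cohomology n M) =
      vcarr (direct_sum (hochschild_cohomology n ?MA) (hochschild_cohomology n ?MB))"
    proof (intro equalityI subsetI)
      fix P assume "P \<in> restriction_map n M ` vcarr (hochschild_cohomology n M)"
      then obtain z where z: "z \<in> ?ZM" and "P = restriction_map n M (z +o ?BM)" by (auto simp: simps)
      then show "P \<in> vcarr (direct_sum (hochschild_cohomology n ?MA) (hochschild_cohomology n ?MB))"
        using cocycles_restrict[OF A z] cocycles_restrict[OF B z] by (auto simp: simps coset)
    next
      fix P assume "P \<in> vcarr (direct_sum (hochschild_cohomology n ?MA) (hochschild_cohomology n ?MB))"
      then obtain u v where u: "u \<in> hochschild_cocycles n ?MA" and v: "v \<in> hochschild_cocycles n ?MB"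
        and P: "P = (u +o ?BA, v +o ?BB)" by (auto simp: simps)
      obtain z where "z \<in> ?ZM" "(z \<circ> map fp_inl) - u \<in> ?BA" "(z \<circ> map fp_inr) - v \<in> ?BB"
        using restriction_isoD(2)[OF iso u v] by blast
      then have "P = restriction_map n M (z +o ?BM)" "z \<in> ?ZM"
        by (simp_all add: P coset coset_eq_iff[OF sub(2), symmetric] coset_eq_iff[OF sub(3), symmetric])
      then show "P \<in> restriction_map n M ` vcarr (hochschild_cohomology n M)" by (simp add: simps)
    qed
  next
    fix X Y assume "X \<in> vcarr (hochschild_cohomology n M)" "Y \<in> vcarr (hochschild_cohomology n M)"
    then show "restriction_map n M (vadd (hochschild_cohomology n M) X Y) =
      vadd (direct_sum (hochschild_cohomology n ?MA) (hochschild_cohomology n ?MB))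
        (restriction_map n M X) (restriction_map n M Y)"
      by (auto simp: simps coset coset_add[OF sub(1)] coset_add[OF sub(2)] coset_add[OF sub(3)] comp)
  next
    fix c X assume "X \<in> vcarr (hochschild_cohomology n M)"
    then show "restriction_map n M (vscale (hochschild_cohomology n M) c X) =
      vscale (direct_sum (hochschild_cohomology n ?MA) (hochschild_cohomology n ?MB)) c
        (restriction_map n M X)"
      by (auto simp: simps coset scale[OF M] scale[OF MA] scale[OF MB] comp)
  qed
qed

lemma restriction_map_natural:
  assumes M: "bimodule M" and N: "bimodule N" and f: "bimodule_hom M N f"
    and x: "x \<in> vcarr (hochschild_cohomology n M)"
  shows "restriction_map n N (hochschild_map n N f x) =
    map_prod (hochschild_map n (restrict_bimodule fp_inl N) f)
      (hochschild_map n (restrict_bimodule fp_inr N) f) (restriction_map n M x)"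
proof -
  note A = algebra_hom_fp_inl and B = algebra_hom_fp_inr
  obtain z where z: "z \<in> hochschild_cocycles n M" and x: "x = z +o hochschild_coboundaries n M"
    using x by (auto simp: hochschild_cohomology_def quotient_space_def)
  show ?thesis
    by (simp add: x hochschild_map_coset[OF M N f z] restriction_map_coset M N comp_assoc
        hochschild_map_coset[OF bimodule_restrict[OF M A] bimodule_restrict[OF N A]
          bimodule_hom_restrict[OF f] cocycles_restrict[OF A z]]
        hochschild_map_coset[OF bimodule_restrict[OF M B] bimodule_restrict[OF N B]
          bimodule_hom_restrict[OF f] cocycles_restrict[OF B z]])
qed

theorem theorem5p2:
  fixes \<Delta>A :: "'a::complex_algebra \<Rightarrow> ('a, 'a) tensor" and \<epsilon>A :: "'a \<Rightarrow> complex" and SA :: "'a \<Rightarrow> 'a"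
    and \<Delta>B :: "'b::complex_algebra \<Rightarrow> ('b, 'b) tensor" and \<epsilon>B :: "'b \<Rightarrow> complex" and SB :: "'b \<Rightarrow> 'b"
    and n :: nat
  assumes "hopf_algebra \<Delta>A \<epsilon>A SA" and "hopf_algebra \<Delta>B \<epsilon>B SB" and "n \<ge> 2"
  shows "\<exists>\<Phi> :: (('a, 'b) free_product, 'm::complex_vector) bimod
                \<Rightarrow> (('a, 'b) free_product list \<Rightarrow> 'm) set
                \<Rightarrow> ('a list \<Rightarrow> 'm) set \<times> ('b list \<Rightarrow> 'm) set.
    (\<forall>M. bimodule M \<longrightarrow>
      linear_iso
        (hochschild_cohomology n M)
        (direct_sum (hochschild_cohomology n (restrict_bimodule fp_inl M))
                    (hochschild_cohomology n (restrict_bimodule fp_inr M)))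
        (\<Phi> M)) \<and>
    (\<forall>M N f. bimodule M \<and> bimodule N \<and> bimodule_hom M N f \<longrightarrow>
      (\<forall>x \<in> vcarr (hochschild_cohomology n M).
        \<Phi> N (hochschild_map n N f x) =
          map_prod (hochschild_map n (restrict_bimodule fp_inl N) f)
                   (hochschild_map n (restrict_bimodule fp_inr N) f) (\<Phi> M x)))"
proof (rule exI[of _ "restriction_map n"], intro conjI allI impI ballI)
  fix M :: "(('a, 'b) free_product, 'm) bimod"
  assume "bimodule M"
  then show "linear_iso (hochschild_cohomology n M)
      (direct_sum (hochschild_cohomology n (restrict_bimodule fp_inl M))
        (hochschild_cohomology n (restrict_bimodule fp_inr M))) (restriction_map n M)"
    using hopf_algebra.counit_hom[OF assms(1)] hopf_algebra.counit_hom[OF assms(2)] assms(3)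
    by (intro linear_iso_restriction_map restriction_iso_free_product)
next
  fix M N :: "(('a, 'b) free_product, 'm) bimod" and f x
  assume "bimodule M \<and> bimodule N \<and> bimodule_hom M N f" and "x \<in> vcarr (hochschild_cohomology n M)"
  then show "restriction_map n N (hochschild_map n N f x) =
      map_prod (hochschild_map n (restrict_bimodule fp_inl N) f)
        (hochschild_map n (restrict_bimodule fp_inr N) f) (restriction_map n M x)"
    using restriction_map_natural by blast
qed

end
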